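(* Let $(G,\mu)$ be a weighted graph satisfying the $p_0$-condition, the $d_f$-set condition and the sub-Gaussian heat kernel estimates (with exponents $d_f>0$ and $d_w>1$). Let $p_n(\boldsymbol{x},\boldsymbol{y})$ denote the $n$-step transition probability of the switch-walk-switch lamplighter walk $\{Y_n\}_{n\ge0}$ on $\mathbb{Z}_2\wr G$, and let $m_{\mathbb{Z}_2\wr G}$ be its reversible measure. Then $$\frac{p_{2n}(\boldsymbol{x},\boldsymbol{x})}{m_{\mathbb{Z}_2\wr G}(\boldsymbol{x})}\approx \exp\left[-n^{\frac{d_f}{d_f+d_w}}\right]\qquad \text{for all } \boldsymbol{x}\in V(\mathbb{Z}_2\wr G);$$ that is, there exist constants $c_1,c_2,c_3,c_4>0$, independent of $n$ and $\boldsymbol{x}$, such that for all $\boldsymbol{x}\in V(\mathbb{Z}_2\wr G)$ and all $n$, $$c_1\exp\left[-(c_2n)^{\frac{d_f}{d_f+d_w}}\right]\le \frac{p_{2n}(\boldsymbol{x},\boldsymbol{x})}{m_{\mathbb{Z}_2\wr G}(\boldsymbol{x})}\le c_3\exp\left[-(c_4n)^{\frac{d_f}{d_f+d_w}}\right].$$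
   Context: Weighted graph: $G=(V(G),E(G))$ is an infinite, locally finite, connected graph with countable vertex set, with graph distance $d$. $\mu:V(G)\times V(G)\to[0,\infty)$ is symmetric, with $\mu_{xy}=\mu(x,y)>0$ if and only if $(x,y)\in E(G)$. Put $m(x)=\sum_{y}\mu_{xy}$, $m(A)=\sum_{x\in A}m(x)$, $B(x,r)=\{y:d(x,y)\le r\}$, $V(x,r)=m(B(x,r))$. $\{X_n\}_{n\ge0}$ is the Markov chain on $V(G)$ with transition probability $p(x,y)=\mu_{xy}/m(x)$, $P_x$ is its law when $X_0=x$, and $p_n(x,y)=P_x(X_n=y)$. $p_0$-condition: there is $p_0>0$ with $\mu_{xy}/m(x)\ge p_0$ whenever $\{x,y\}\in E(G)$. $d_f$-set condition: there are constants $d_f,c_1,c_2>0$ with $c_1r^{d_f}\le V(x,r)\le c_2r^{d_f}$ for all $x\in V(G)$ and $r\in\mathbb{N}\cup\{0\}$, where $0^{d_f}$ is regarded as $1$. Sub-Gaussian heat kernel estimates: there are $d_w>1$ and constants $c_1,c_2,c_3,c_4>0$ such that $$\frac{p_n(x,y)}{m(y)}\le\frac{c_1}{V(x,n^{1/d_w})}\exp\left(-c_2\left(\frac{d(x,y)^{d_w}}{n}\right)^{\frac1{d_w-1}}\right)$$ for all $x,y\in V(G)$, $n\ge1$, and $$\frac{p_n(x,y)}{m(y)}+\frac{p_{n+1}(x,y)}{m(y)}\ge\frac{c_3}{V(x,n^{1/d_w})}\exp\left(-c_4\left(\frac{d(x,y)^{d_w}}{n}\right)^{\frac1{d_w-1}}\right)$$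 for all $x,y\in V(G)$, $n\ge1$ with $d(x,y)\le n$. Wreath product: $\mathbb{Z}_2=\{0,1\}$ is the graph with two vertices and one edge joining them. $V(\mathbb{Z}_2\wr G)$ is the set of pairs $(f,v)$ with $v\in V(G)$ and $f:V(G)\to\{0,1\}$ with $\{x:f(x)\ne0\}$ finite; $(f,u)$ and $(g,v)$ are adjacent iff either $f=g$ and $(u,v)\in E(G)$, or $u=v$, $f=g$ off $u$, and $f(u)\ne g(u)$. Lamplighter walk: $Y_n=(\eta_n,X_n)$ is the Markov chain on $V(\mathbb{Z}_2\wr G)$ with transition probability $\tilde p=Q*\tilde P*Q$ (composition of kernels), where $\tilde P((f,x),(g,y))=p(x,y)$ if $f=g$ and $0$ otherwise, and $Q((f,x),(g,y))=1/2$ if $x=y$ and $f(v)=g(v)$ for all $v\ne x$, and $0$ otherwise. It is reversible with respect to $m_{\mathbb{Z}_2\wr G}((\eta,x))=m(x)$. *)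

theory Defs
  imports
    "HOL-Probability.Probability"
    "HOL-Library.Poly_Mapping"
    "HOL-Library.Z2"
begin

section \<open>Weighted graphs\<close>

text \<open>The vertex set is the whole type \<open>'v\<close>. Symmetry of \<open>E\<close> is a consequence of \<open>symmetric\<close> and
  \<open>weight_pos_iff\<close>; loops are not excluded.\<close>

locale weighted_graph =
  fixes E :: "('v \<times> 'v) set" and \<mu> :: "'v \<Rightarrow> 'v \<Rightarrow> real"
  assumes countable_vertices: "countable (UNIV :: 'v set)"
    and infinite_vertices: "infinite (UNIV :: 'v set)"
    and locally_finite: "\<And>x. finite {y. (x, y) \<in> E}"
    and connected: "\<And>x y. (x, y) \<in> E\<^sup>*"
    and weight_nonneg: "\<And>x y. 0 \<le> \<mu> x y"
    and symmetric: "\<And>x y. \<mu> x y = \<mu> y x"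
    and weight_pos_iff: "\<And>x y. 0 < \<mu> x y \<longleftrightarrow> (x, y) \<in> E"

definition graph_dist :: "('v \<times> 'v) set \<Rightarrow> 'v \<Rightarrow> 'v \<Rightarrow> nat" where
  "graph_dist E x y = (LEAST n. (x, y) \<in> E ^^ n)"

definition graph_ball :: "('v \<times> 'v) set \<Rightarrow> 'v \<Rightarrow> real \<Rightarrow> 'v set" where
  "graph_ball E x r = {y. real (graph_dist E x y) \<le> r}"

definition vertex_weight :: "('v \<Rightarrow> 'v \<Rightarrow> real) \<Rightarrow> 'v \<Rightarrow> real" where
  "vertex_weight \<mu> x = (\<Sum>\<^sub>\<infinity>y. \<mu> x y)"

text \<open>Balls are finite in a locally finite connected graph, so a finite sum suffices.\<close>

definition volume :: "('v \<times> 'v) set \<Rightarrow> ('v \<Rightarrow> 'v \<Rightarrow> real) \<Rightarrow> 'v \<Rightarrow> real \<Rightarrow> real" where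
  "volume E \<mu> x r = (\<Sum>y\<in>graph_ball E x r. vertex_weight \<mu> y)"

definition trans_prob :: "('v \<Rightarrow> 'v \<Rightarrow> real) \<Rightarrow> 'v \<Rightarrow> 'v \<Rightarrow> real" where
  "trans_prob \<mu> x y = \<mu> x y / vertex_weight \<mu> x"

definition p0_condition :: "('v \<times> 'v) set \<Rightarrow> ('v \<Rightarrow> 'v \<Rightarrow> real) \<Rightarrow> bool" where
  "p0_condition E \<mu> \<longleftrightarrow>
     (\<exists>p\<^sub>0>0. \<forall>x y. (x, y) \<in> E \<longrightarrow> \<mu> x y / vertex_weight \<mu> x \<ge> p\<^sub>0)"

text \<open>In this condition the value of \<open>0 powr d\<^sub>f\<close> is regarded as \<open>1\<close> (the library value is \<open>0\<close>).\<close>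

definition df_set_condition :: "('v \<times> 'v) set \<Rightarrow> ('v \<Rightarrow> 'v \<Rightarrow> real) \<Rightarrow> real \<Rightarrow> bool" where
  "df_set_condition E \<mu> d\<^sub>f \<longleftrightarrow>
     d\<^sub>f > 0 \<and>
     (\<exists>c\<^sub>1>0. \<exists>c\<^sub>2>0. \<forall>x. \<forall>r::nat.
        c\<^sub>1 * (if r = 0 then 1 else real r powr d\<^sub>f) \<le> volume E \<mu> x (real r) \<and>
        volume E \<mu> x (real r) \<le> c\<^sub>2 * (if r = 0 then 1 else real r powr d\<^sub>f))"

section \<open>Markov chains\<close>

text \<open>\<open>X\<close> is a Markov chain with transition kernel \<open>K\<close> started at \<open>x\<close> under \<open>M\<close>,
  expressed through its finite-dimensional distributions.\<close>

definition markov_chain ::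
  "('s \<Rightarrow> 's \<Rightarrow> real) \<Rightarrow> 's \<Rightarrow> 'w measure \<Rightarrow> (nat \<Rightarrow> 'w \<Rightarrow> 's) \<Rightarrow> bool" where
  "markov_chain K x M X \<longleftrightarrow>
     prob_space M \<and>
     (\<forall>n. X n \<in> measurable M (count_space UNIV)) \<and>
     (\<forall>n. \<forall>s::nat \<Rightarrow> 's.
        \<P>(\<omega> in M. \<forall>i\<le>n. X i \<omega> = s i) =
          (if s 0 = x then 1 else 0) * (\<Prod>i<n. K (s i) (s (Suc i))))"

definition n_step_prob ::
  "('s \<Rightarrow> 'w measure) \<Rightarrow> (nat \<Rightarrow> 'w \<Rightarrow> 's) \<Rightarrow> nat \<Rightarrow> 's \<Rightarrow> 's \<Rightarrow> real" where
  "n_step_prob P X n x y = \<P>(\<omega> in P x. X n \<omega> = y)"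

text \<open>The argument \<open>p\<close> is the family of \<open>n\<close>-step transition probabilities of the walk.\<close>

definition sub_gaussian_estimates ::
  "('v \<times> 'v) set \<Rightarrow> ('v \<Rightarrow> 'v \<Rightarrow> real) \<Rightarrow> (nat \<Rightarrow> 'v \<Rightarrow> 'v \<Rightarrow> real) \<Rightarrow> real \<Rightarrow> bool" where
  "sub_gaussian_estimates E \<mu> p d\<^sub>w \<longleftrightarrow>
     d\<^sub>w > 1 \<and>
     (\<exists>c\<^sub>1>0. \<exists>c\<^sub>2>0. \<exists>c\<^sub>3>0. \<exists>c\<^sub>4>0. \<forall>x y. \<forall>n::nat. n \<ge> 1 \<longrightarrow>
        p n x y / vertex_weight \<mu> y
          \<le> c\<^sub>1 / volume E \<mu> x (real n powr (1 / d\<^sub>w)) *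
             exp (- c\<^sub>2 * (real (graph_dist E x y) powr d\<^sub>w / real n) powr (1 / (d\<^sub>w - 1))) \<and>
        (graph_dist E x y \<le> n \<longrightarrow>
          p n x y / vertex_weight \<mu> y + p (n + 1) x y / vertex_weight \<mu> y
            \<ge> c\<^sub>3 / volume E \<mu> x (real n powr (1 / d\<^sub>w)) *
               exp (- c\<^sub>4 * (real (graph_dist E x y) powr d\<^sub>w / real n) powr (1 / (d\<^sub>w - 1)))))"

section \<open>The switch-walk-switch lamplighter walk\<close>

text \<open>Vertices of the wreath product of \<open>\<int>\<^sub>2\<close> with the graph: a finitely supported lamp
  configuration \<open>'v \<Rightarrow>\<^sub>0 bit\<close> together with the position of the walker.\<close>

type_synonym 'v wreath = "('v \<Rightarrow>\<^sub>0 bit) \<times> 'v"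

definition kernel_comp ::
  "('s \<Rightarrow> 's \<Rightarrow> real) \<Rightarrow> ('s \<Rightarrow> 's \<Rightarrow> real) \<Rightarrow> 's \<Rightarrow> 's \<Rightarrow> real" where
  "kernel_comp K L x y = (\<Sum>\<^sub>\<infinity>z. K x z * L z y)"

fun walk_kernel :: "('v \<Rightarrow> 'v \<Rightarrow> real) \<Rightarrow> 'v wreath \<Rightarrow> 'v wreath \<Rightarrow> real" where
  "walk_kernel \<mu> (f, x) (g, y) = (if f = g then trans_prob \<mu> x y else 0)"

fun switch_kernel :: "'v wreath \<Rightarrow> 'v wreath \<Rightarrow> real" where
  "switch_kernel (f, x) (g, y) =
     (if x = y \<and> (\<forall>v. v \<noteq> x \<longrightarrow> Poly_Mapping.lookup f v = Poly_Mapping.lookup g v) then 1 / 2 else 0)"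

definition lamplighter_kernel :: "('v \<Rightarrow> 'v \<Rightarrow> real) \<Rightarrow> 'v wreath \<Rightarrow> 'v wreath \<Rightarrow> real" where
  "lamplighter_kernel \<mu> =
     kernel_comp (kernel_comp switch_kernel (walk_kernel \<mu>)) switch_kernel"

fun wreath_weight :: "('v \<Rightarrow> 'v \<Rightarrow> real) \<Rightarrow> 'v wreath \<Rightarrow> real" where
  "wreath_weight \<mu> (\<eta>, x) = vertex_weight \<mu> x"

end

theory Submission
  imports Defs
begin

text \<open>Every site visited by the walker gets its lamp rerandomized, so after \<open>n \<ge> 1\<close> steps the visited
  lamps are independent fair coin flips and
  \<open>p\<^bsub>n\<^esub>((f, x), (f, x)) = E\<^sub>x [2\<^bsup>-|R\<^sub>n|\<^esup>; X\<^sub>n = x]\<close>, where \<open>R\<^sub>n = {X\<^sub>0, \<dots>, X\<^sub>n}\<close>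
  (\<open>kernel_pow_lamplighter\<close>). Vertex weights are bounded above and below, so only this expectation
  matters. Write \<open>\<gamma> = d\<^sub>f / d\<^sub>w\<close>, \<open>\<alpha> = d\<^sub>f / (d\<^sub>f + d\<^sub>w)\<close> and \<open>\<theta> = d\<^sub>w / (d\<^sub>f + d\<^sub>w) = 1 - \<alpha>\<close>. Time is cut
  into blocks of \<open>k \<approx> n\<^bsup>\<theta>\<^esup>\<close> steps; there are about \<open>n\<^bsup>\<alpha>\<^esup>\<close> of them, and balls of radius of order
  \<open>k\<^bsup>1/d\<^sub>w\<^esup>\<close> have about \<open>k\<^bsup>\<gamma>\<^esup> \<approx> n\<^bsup>\<alpha>\<^esup>\<close> points.

  Upper bound (\<open>lamplighter_return_upper\<close>). By the heat kernel bound \<open>p\<^sub>k(x, y) \<le> C k\<^bsup>-\<gamma>\<^esup>\<close>, a set of at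
  most \<open>M = k\<^bsup>\<gamma>\<^esup> / (2 C)\<close> points is hit at the end of a block with probability at most \<open>1 / 2\<close>. So as
  long as at most \<open>M\<close> points have been recorded, the position at the end of the next block is a new
  point with probability at least \<open>1 / 2\<close>, and \<open>E 2\<^bsup>-|R|\<^esup>\<close> drops by a factor \<open>3 / 4\<close> per block until
  it is of order \<open>2\<^bsup>-M\<^esup>\<close> (\<open>range_weight_blocks_le\<close>).

  Lower bound (\<open>lamplighter_return_lower\<close>). Let \<open>B\<close> be a ball about \<open>x\<close> of radius a large multiple of
  \<open>k\<^bsup>1/d\<^sub>w\<^esup>\<close>. If the walk does not leave \<open>B\<close>, then \<open>2\<^bsup>-|R|\<^esup> \<ge> 2\<^bsup>-|B|\<^esup> \<ge> exp (- c n\<^bsup>\<alpha>\<^esup>)\<close>, so it remains to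
  bound below the return probabilities \<open>q\<^sub>j\<close> at times \<open>2 j\<close> of the walk killed outside \<open>B\<close>. Killing
  changes them by at most the largest probability that a walk started outside \<open>B\<close> is at \<open>x\<close> at some
  given time, which the off-diagonal estimate makes small compared to \<open>k\<^bsup>-\<gamma>\<^esup>\<close>; hence \<open>q\<^sub>j \<ge> c k\<^bsup>-\<gamma>\<^esup>\<close> for \<open>k \<le> j \<le> 3 k\<close>
  (\<open>killed_even_diagonal_lower\<close>). By reversibility and the Cauchy--Schwarz inequality \<open>q\<close> is
  log-convex, so a single block that costs only a constant factor implies that every later one
  does (\<open>kernel_pow_even_lower_bound\<close>): \<open>q\<^sub>n \<ge> c k\<^bsup>-\<gamma>\<^esup> \<rho>\<^bsup>n/k\<^esup>\<close> for a constant \<open>\<rho> > 0\<close>.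

  All walks have kernels with finitely many targets from each state, so expectations at a fixed
  time are finite sums and are defined by recursion on the time.\<close>

section \<open>Kernels of finite range\<close>

text \<open>Rows need not sum to \<open>1\<close>: kernels of killed walks are included.\<close>

locale finite_range_kernel =
  fixes K :: "'s \<Rightarrow> 's \<Rightarrow> real"
  assumes finite_range: "finite {z. K x z \<noteq> 0}"
    and nonneg: "0 \<le> K x z"

locale stochastic_kernel = finite_range_kernel +
  assumes row_sum: "(\<Sum>z | K x z \<noteq> 0. K x z) = 1"

text \<open>The \<open>n\<close>-th power of \<open>K\<close> acting on functions: \<open>kernel_op K n g x\<close> is the expectation of
  \<open>g (X\<^sub>n)\<close> for the chain started at \<open>x\<close>.\<close>

fun kernel_op :: "('s \<Rightarrow> 's \<Rightarrow> real) \<Rightarrow> nat \<Rightarrow> ('s \<Rightarrow> real) \<Rightarrow> 's \<Rightarrow> real" where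
  "kernel_op K 0 g x = g x"
| "kernel_op K (Suc n) g x = (\<Sum>z | K x z \<noteq> 0. K x z * kernel_op K n g z)"

text \<open>The \<open>n\<close>-step transition probabilities.\<close>

definition kernel_pow :: "('s \<Rightarrow> 's \<Rightarrow> real) \<Rightarrow> nat \<Rightarrow> 's \<Rightarrow> 's \<Rightarrow> real" where
  "kernel_pow K n x y = kernel_op K n (\<lambda>z. if z = y then 1 else 0) x"

text \<open>The expectation of \<open>F [X\<^sub>0, \<dots>, X\<^sub>n]\<close> for the chain started at \<open>x\<close>.\<close>

fun path_expectation ::
  "('s \<Rightarrow> 's \<Rightarrow> real) \<Rightarrow> nat \<Rightarrow> 's \<Rightarrow> ('s list \<Rightarrow> real) \<Rightarrow> real" where
  "path_expectation K 0 x F = F [x]"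
| "path_expectation K (Suc n) x F =
     (\<Sum>z | K x z \<noteq> 0. K x z * path_expectation K n z (\<lambda>l. F (x # l)))"

lemma kernel_op_add: "kernel_op K (a + b) g = kernel_op K a (kernel_op K b g)"
proof (induction a)
  case (Suc a)
  then show ?case by (intro ext) simp
qed (simp add: fun_eq_iff)

lemma kernel_op_sum:
  "kernel_op K n (\<lambda>y. \<Sum>i\<in>I. c i * g i y) x = (\<Sum>i\<in>I. c i * kernel_op K n (g i) x)"
proof (induction n arbitrary: x)
  case (Suc n)
  have "kernel_op K (Suc n) (\<lambda>y. \<Sum>i\<in>I. c i * g i y) x
      = (\<Sum>z | K x z \<noteq> 0. \<Sum>i\<in>I. c i * (K x z * kernel_op K n (g i) z))"
    by (simp add: Suc sum_distrib_left algebra_simps)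
  also have "\<dots> = (\<Sum>i\<in>I. \<Sum>z | K x z \<noteq> 0. c i * (K x z * kernel_op K n (g i) z))"
    by (rule sum.swap)
  finally show ?case by (simp add: sum_distrib_left)
qed simp

lemma kernel_op_add_fun:
  "kernel_op K n (\<lambda>y. g y + h y) x = kernel_op K n g x + kernel_op K n h x"
  by (induction n arbitrary: x) (simp_all add: sum.distrib algebra_simps)

lemma kernel_op_mult: "kernel_op K n (\<lambda>y. c * g y) x = c * kernel_op K n g x"
  by (induction n arbitrary: x) (simp_all add: sum_distrib_left algebra_simps)

lemma kernel_pow_Suc:
  "kernel_pow K (Suc n) x y = (\<Sum>z | K x z \<noteq> 0. K x z * kernel_pow K n z y)"
  by (simp add: kernel_pow_def)

lemma kernel_pow_0: "kernel_pow K 0 x y = (if x = y then 1 else 0)"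
  by (simp add: kernel_pow_def)

lemma path_expectation_cong:
  assumes "\<And>l. l \<noteq> [] \<Longrightarrow> hd l = x \<Longrightarrow> F l = G l"
  shows "path_expectation K n x F = path_expectation K n x G"
  using assms
proof (induction n arbitrary: x F G)
  case (Suc n)
  have "path_expectation K n z (\<lambda>l. F (x # l)) = path_expectation K n z (\<lambda>l. G (x # l))" for z
    by (intro Suc.IH) (simp add: Suc.prems)
  then show ?case by simp
qed simp

lemma path_expectation_mult:
  "path_expectation K n x (\<lambda>l. c * F l) = c * path_expectation K n x F"
  by (induction n arbitrary: x F) (simp_all add: sum_distrib_left algebra_simps)

lemma path_expectation_sum:
  "path_expectation K n x (\<lambda>l. \<Sum>i\<in>I. F i l) = (\<Sum>i\<in>I. path_expectation K n x (F i))"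
proof (induction n arbitrary: x F)
  case (Suc n)
  then show ?case by (simp add: sum_distrib_left) (rule sum.swap)
qed simp

lemma (in finite_range_kernel) sum_kernel_mono:
  assumes "\<And>z. K x z \<noteq> 0 \<Longrightarrow> f z \<le> g z"
  shows "(\<Sum>z | K x z \<noteq> 0. K x z * f z) \<le> (\<Sum>z | K x z \<noteq> 0. K x z * g z)"
  using assms by (intro sum_mono mult_left_mono) (auto simp: nonneg)

lemma (in finite_range_kernel) kernel_op_mono:
  assumes "\<And>y. g y \<le> h y"
  shows "kernel_op K n g x \<le> kernel_op K n h x"
proof (induction n arbitrary: x)
  case (Suc n)
  then show ?case unfolding kernel_op.simps by (intro sum_kernel_mono)
qed (simp add: assms)

lemma (in finite_range_kernel) kernel_pow_nonneg: "0 \<le> kernel_pow K n x y"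
proof (induction n arbitrary: x)
  case (Suc n)
  then show ?case unfolding kernel_pow_Suc by (intro sum_nonneg mult_nonneg_nonneg nonneg)
qed (simp add: kernel_pow_0)

lemma (in finite_range_kernel) path_expectation_mono:
  assumes "\<And>l. F l \<le> G l"
  shows "path_expectation K n x F \<le> path_expectation K n x G"
  using assms
proof (induction n arbitrary: x F G)
  case (Suc n)
  have "path_expectation K n z (\<lambda>l. F (x # l)) \<le> path_expectation K n z (\<lambda>l. G (x # l))" for z
    by (intro Suc.IH Suc.prems)
  then show ?case unfolding path_expectation.simps by (intro sum_kernel_mono)
qed simp

lemma (in stochastic_kernel) kernel_op_const: "kernel_op K n (\<lambda>_. c) x = c"
  by (induction n arbitrary: x) (simp_all add: row_sum flip: sum_distrib_right)

lemma (in stochastic_kernel) path_expectation_const: "path_expectation K n x (\<lambda>_. c) = c"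
  by (induction n arbitrary: x) (simp_all add: row_sum flip: sum_distrib_right)

text \<open>For a given starting point and a given number of steps, the kernel operator is a finite sum
  against the powers of the kernel. The sum may run over any finite set that contains the points
  reachable in that number of steps, so that two such sums can be taken over the same set.\<close>

lemma (in finite_range_kernel) kernel_op_eq_sum:
  "\<exists>A. finite A \<and> (\<forall>g B. finite B \<longrightarrow> A \<subseteq> B \<longrightarrow>
     kernel_op K n g x = (\<Sum>z\<in>B. kernel_pow K n x z * g z))"
proof -
  have "\<exists>A. finite A \<and> (\<forall>g h. (\<forall>z\<in>A. g z = h z) \<longrightarrow> kernel_op K n g x = kernel_op K n h x)"
  proof (induction n arbitrary: x)
    case 0
    show ?case by (rule exI[of _ "{x}"]) simp
  next
    case (Suc n)
    then obtain A where A: "\<And>x. finite (A x)"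
      "\<And>x g h. \<forall>z\<in>A x. g z = h z \<Longrightarrow> kernel_op K n g x = kernel_op K n h x"
      by metis
    show ?case
    proof (intro exI[of _ "\<Union>z\<in>{z. K x z \<noteq> 0}. A z"] conjI allI impI)
      show "finite (\<Union>z\<in>{z. K x z \<noteq> 0}. A z)" using A finite_range by simp
      fix g h :: "'s \<Rightarrow> real"
      assume *: "\<forall>z\<in>(\<Union>z\<in>{z. K x z \<noteq> 0}. A z). g z = h z"
      have "kernel_op K n g z = kernel_op K n h z" if "K x z \<noteq> 0" for z
        using * that by (intro A(2)) auto
      then show "kernel_op K (Suc n) g x = kernel_op K (Suc n) h x"
        unfolding kernel_op.simps by (intro sum.cong) auto
    qed
  qed
  then obtain A where A: "finite A"
    "\<And>g h. \<forall>z\<in>A. g z = h z \<Longrightarrow> kernel_op K n g x = kernel_op K n h x" by blast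
  have "kernel_op K n g x = (\<Sum>z\<in>B. kernel_pow K n x z * g z)" if B: "finite B" "A \<subseteq> B" for g B
  proof -
    have "kernel_op K n g x = kernel_op K n (\<lambda>w. \<Sum>z\<in>B. g z * (if w = z then 1 else 0)) x"
      using B by (intro A(2)) (auto simp: sum.delta' if_distrib cong: if_cong)
    also have "\<dots> = (\<Sum>z\<in>B. g z * kernel_pow K n x z)"
      unfolding kernel_op_sum kernel_pow_def ..
    finally show ?thesis by (simp add: mult.commute)
  qed
  with A(1) show ?thesis by blast
qed

lemma (in finite_range_kernel) kernel_pow_add:
  "\<exists>A. finite A \<and> (\<forall>b y B. finite B \<longrightarrow> A \<subseteq> B \<longrightarrow>
     kernel_pow K (a + b) x y = (\<Sum>z\<in>B. kernel_pow K a x z * kernel_pow K b z y))"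
proof -
  obtain A where A: "finite A" "\<And>g B. finite B \<Longrightarrow> A \<subseteq> B \<Longrightarrow>
      kernel_op K a g x = (\<Sum>z\<in>B. kernel_pow K a x z * g z)"
    using kernel_op_eq_sum[of a x] by blast
  have "kernel_pow K (a + b) x y = kernel_op K a (\<lambda>z. kernel_pow K b z y) x" for b y
    by (simp add: kernel_pow_def kernel_op_add)
  then show ?thesis using A by metis
qed

subsection \<open>Reversible kernels\<close>

locale reversible_kernel = finite_range_kernel +
  fixes m :: "'a \<Rightarrow> real"
  assumes weight_pos: "0 < m x"
    and reversible: "m x * K x y = m y * K y x"
begin

lemma kernel_pow_reversible: "m x * kernel_pow K n x y = m y * kernel_pow K n y x"
proof (induction n arbitrary: x y)
  case 0
  show ?case by (simp add: kernel_pow_0)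
next
  case (Suc n)
  obtain A where A: "finite A" "\<And>b z B. finite B \<Longrightarrow> A \<subseteq> B \<Longrightarrow>
      kernel_pow K (n + b) y z = (\<Sum>w\<in>B. kernel_pow K n y w * kernel_pow K b w z)"
    using kernel_pow_add[of n y] by blast
  define B where "B = A \<union> {z. K x z \<noteq> 0}"
  have B: "finite B" "A \<subseteq> B" using A(1) finite_range by (auto simp: B_def)
  have one: "kernel_pow K 1 w z = K w z" for w z
    using finite_range[of w] by (simp add: kernel_pow_Suc kernel_pow_0 if_distrib cong: if_cong)
  have zero: "K x z = 0 \<longleftrightarrow> K z x = 0" for z
    using reversible[of x z] weight_pos[of x] weight_pos[of z] by (metis mult_eq_0_iff less_irrefl)
  have "m x * kernel_pow K (Suc n) x y = (\<Sum>z | K x z \<noteq> 0. m x * K x z * kernel_pow K n z y)"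
    by (simp add: kernel_pow_Suc sum_distrib_left mult.assoc)
  also have "\<dots> = (\<Sum>z\<in>B. m x * K x z * kernel_pow K n z y)"
    by (rule sum.mono_neutral_left) (use B in \<open>auto simp: B_def\<close>)
  also have "\<dots> = (\<Sum>z\<in>B. m y * (kernel_pow K n y z * K z x))"
  proof (rule sum.cong[OF refl])
    fix z
    have "m x * K x z * kernel_pow K n z y = K z x * (m z * kernel_pow K n z y)"
      by (simp add: reversible algebra_simps)
    also have "\<dots> = m y * (kernel_pow K n y z * K z x)" by (simp add: Suc algebra_simps)
    finally show "m x * K x z * kernel_pow K n z y = m y * (kernel_pow K n y z * K z x)" .
  qed
  also have "\<dots> = m y * kernel_pow K (Suc n) y x"
    using A(2)[OF B, of 1 x] by (simp add: sum_distrib_left one[unfolded One_nat_def])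
  finally show ?case .
qed

text \<open>Cauchy--Schwarz in \<open>\<ell>\<^sup>2(1/m)\<close> for the distributions of the chain after \<open>a\<close> and after \<open>b\<close>
  steps.\<close>

lemma kernel_pow_log_convex:
  "(kernel_pow K (a + b) x x)\<^sup>2 \<le> kernel_pow K (2 * a) x x * kernel_pow K (2 * b) x x"
proof -
  obtain A1 where A1: "finite A1" "\<And>b y B. finite B \<Longrightarrow> A1 \<subseteq> B \<Longrightarrow>
      kernel_pow K (a + b) x y = (\<Sum>z\<in>B. kernel_pow K a x z * kernel_pow K b z y)"
    using kernel_pow_add[of a x] by blast
  obtain A2 where A2: "finite A2" "\<And>c y B. finite B \<Longrightarrow> A2 \<subseteq> B \<Longrightarrow>
      kernel_pow K (b + c) x y = (\<Sum>z\<in>B. kernel_pow K b x z * kernel_pow K c z y)"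
    using kernel_pow_add[of b x] by blast
  define B where "B = A1 \<union> A2"
  have B: "finite B" "A1 \<subseteq> B" "A2 \<subseteq> B" using A1(1) A2(1) by (auto simp: B_def)
  define u where "u n z = kernel_pow K n x z * sqrt (m x / m z)" for n z
  have uu: "kernel_pow K i x z * kernel_pow K j z x = u i z * u j z" for i j z
  proof -
    have "kernel_pow K j z x = kernel_pow K j x z * (m x / m z)"
      using kernel_pow_reversible[of x j z] weight_pos[of z] by (simp add: field_simps)
    moreover have "sqrt (m x / m z) * sqrt (m x / m z) = m x / m z"
      using weight_pos[of x] weight_pos[of z] by simp
    ultimately have "kernel_pow K i x z * kernel_pow K j z x =
        kernel_pow K i x z * (kernel_pow K j x z * (sqrt (m x / m z) * sqrt (m x / m z)))"
      by presburger
    then show ?thesis by (simp only: u_def mult_ac)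
  qed
  have "(\<Sum>z\<in>B. u a z * u b z)\<^sup>2 \<le> (\<Sum>z\<in>B. (u a z)\<^sup>2) * (\<Sum>z\<in>B. (u b z)\<^sup>2)"
    by (rule Cauchy_Schwarz_ineq_sum)
  then show ?thesis
    using A1(2)[OF B(1,2), of b x] A1(2)[OF B(1,2), of a x] A2(2)[OF B(1,3), of b x]
    by (simp add: uu power2_eq_square mult_2)
qed

text \<open>By log-convexity the ratios of successive terms of \<open>i \<mapsto> K\<^bsup>2(s + i k)\<^esup>(x, x)\<close> do not decrease,
  so a lower bound for the first ratio gives an exponential lower bound.\<close>

lemma kernel_pow_even_lower_bound:
  assumes l: "0 < l" "l \<le> kernel_pow K (2 * s) x x" "l \<le> kernel_pow K (2 * (s + k)) x x"
    and u: "kernel_pow K (2 * s) x x \<le> u"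
  shows "l * (l / u) ^ i \<le> kernel_pow K (2 * (s + i * k)) x x"
proof -
  define b where "b i = kernel_pow K (2 * (s + i * k)) x x" for i
  have u0: "0 < u" using l u by linarith
  have convex: "b (Suc i) * b (Suc i) \<le> b i * b (Suc (Suc i))" for i
  proof -
    have "(s + i * k) + (s + Suc (Suc i) * k) = 2 * (s + Suc i * k)" by simp
    then show ?thesis
      using kernel_pow_log_convex[of "s + i * k" "s + Suc (Suc i) * k" x]
      unfolding b_def power2_eq_square by metis
  qed
  have "0 < b i \<and> l / u * b i \<le> b (Suc i)" for i
  proof (induction i)
    case 0
    have "l / u * b 0 \<le> l / u * u"
      using l u u0 by (intro mult_left_mono) (auto simp: b_def)
    then show ?case using l u0 by (simp add: b_def)
  next
    case (Suc i)
    have "0 < l / u * b i" using Suc l u0 by simp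
    with Suc have pos: "0 < b (Suc i)" by linarith
    have "b i * (l / u * b (Suc i)) = (l / u * b i) * b (Suc i)" by simp
    also have "\<dots> \<le> b (Suc i) * b (Suc i)" using Suc pos by (intro mult_right_mono) auto
    also have "\<dots> \<le> b i * b (Suc (Suc i))" by (rule convex)
    finally have "l / u * b (Suc i) \<le> b (Suc (Suc i))"
      using Suc mult_le_cancel_left_pos by blast
    with pos show ?case by blast
  qed
  note ratio = this
  have "l * (l / u) ^ i \<le> b i" for i
  proof (induction i)
    case 0
    show ?case using l by (simp add: b_def)
  next
    case (Suc i)
    have "l * (l / u) ^ Suc i = l / u * (l * (l / u) ^ i)" by simp
    also have "\<dots> \<le> l / u * b i" using Suc l u0 by (intro mult_left_mono) auto
    also have "\<dots> \<le> b (Suc i)" using ratio by blast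
    finally show ?case .
  qed
  then show ?thesis by (simp add: b_def)
qed

end

subsection \<open>Killing outside a set\<close>

text \<open>The kernel of the walk that dies when it leaves \<open>B\<close>. Steps from outside \<open>B\<close> are removed as
  well, to keep the kernel reversible.\<close>

definition killed :: "'s set \<Rightarrow> ('s \<Rightarrow> 's \<Rightarrow> real) \<Rightarrow> 's \<Rightarrow> 's \<Rightarrow> real" where
  "killed B K x y = (if x \<in> B \<and> y \<in> B then K x y else 0)"

lemma (in finite_range_kernel) finite_range_kernel_killed: "finite_range_kernel (killed B K)"
proof
  show "finite {z. killed B K x z \<noteq> 0}" for x
    by (rule finite_subset[OF _ finite_range[of x]]) (auto simp: killed_def)
qed (simp add: killed_def nonneg)

lemma (in reversible_kernel) reversible_kernel_killed: "reversible_kernel (killed B K) m"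
proof -
  interpret k: finite_range_kernel "killed B K" by (rule finite_range_kernel_killed)
  show ?thesis by standard (auto simp: weight_pos killed_def reversible)
qed

context finite_range_kernel
begin

lemma kernel_pow_killed_Suc:
  assumes "x \<in> B"
  shows "kernel_pow (killed B K) (Suc n) x y =
    (\<Sum>z | K x z \<noteq> 0. K x z * (if z \<in> B then kernel_pow (killed B K) n z y else 0))"
  unfolding kernel_pow_Suc using assms finite_range
  by (intro sum.mono_neutral_cong_left) (auto simp: killed_def)

lemma kernel_pow_killed_le_path_expectation:
  assumes "x \<in> B"
  shows "kernel_pow (killed B K) n x y \<le>
    path_expectation K n x (\<lambda>l. if last l = y \<and> set l \<subseteq> B then 1 else 0)"
  using assms
proof (induction n arbitrary: x)
  case 0
  then show ?case by (simp add: kernel_pow_0)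
next
  case (Suc n)
  let ?F = "\<lambda>l. if last l = y \<and> set l \<subseteq> B then 1 else 0 :: real"
  have "path_expectation K n z (\<lambda>l. ?F (x # l)) = path_expectation K n z ?F" for z
    using Suc.prems by (intro path_expectation_cong) auto
  moreover have "0 \<le> path_expectation K n z ?F" for z
    using path_expectation_mono[of "\<lambda>_. 0" ?F n z] path_expectation_mult[of K n z 0 ?F] by simp
  ultimately show ?case
    unfolding kernel_pow_killed_Suc[OF Suc.prems] path_expectation.simps
    using Suc.IH by (intro sum_kernel_mono) auto
qed

lemma kernel_pow_killed_le:
  "kernel_pow (killed B K) n x y \<le> kernel_pow K n x y"
proof (induction n arbitrary: x)
  case (Suc n)
  show ?case
  proof (cases "x \<in> B")
    case True
    show ?thesis unfolding kernel_pow_killed_Suc[OF True] kernel_pow_Suc[of K]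
      using Suc by (intro sum_kernel_mono) (auto simp: kernel_pow_nonneg)
  next
    case False
    then have "kernel_pow (killed B K) (Suc n) x y = 0"
      by (simp add: kernel_pow_Suc killed_def)
    then show ?thesis using kernel_pow_nonneg[of "Suc n" x y] by simp
  qed
qed (simp add: kernel_pow_0)

end

text \<open>A path that ends at \<open>y\<close> but leaves \<open>B\<close> has to reach \<open>y\<close> from its first point outside \<open>B\<close> in
  the remaining time.\<close>

lemma (in stochastic_kernel) kernel_pow_le_killed:
  assumes "0 \<le> \<beta>" "\<And>j w. j \<le> n \<Longrightarrow> w \<notin> B \<Longrightarrow> kernel_pow K j w y \<le> \<beta>" "x \<in> B"
  shows "kernel_pow K n x y \<le> kernel_pow (killed B K) n x y + \<beta>"
  using assms
proof (induction n arbitrary: x)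
  case 0
  then show ?case by (simp add: kernel_pow_0)
next
  case (Suc n)
  have "kernel_pow K (Suc n) x y \<le>
      (\<Sum>z | K x z \<noteq> 0. K x z * ((if z \<in> B then kernel_pow (killed B K) n z y else 0) + \<beta>))"
    unfolding kernel_pow_Suc using Suc by (intro sum_kernel_mono) auto
  also have "\<dots> = kernel_pow (killed B K) (Suc n) x y + \<beta>"
    using row_sum[of x]
    by (simp add: kernel_pow_killed_Suc[OF \<open>x \<in> B\<close>] distrib_left sum.distrib flip: sum_distrib_right)
  finally show ?case .
qed

subsection \<open>Markov chains\<close>

text \<open>The finite-dimensional distributions determine the law of \<open>X\<^sub>n\<close>. The state space need not be
  countable, since rows of finite support that sum to \<open>1\<close> leave no mass elsewhere.\<close>

lemma markov_chain_prob_eq_kernel_pow: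
  assumes "stochastic_kernel K" and mc: "markov_chain K x M X"
  shows "\<P>(\<omega> in M. X n \<omega> = y) = kernel_pow K n x y"
proof -
  interpret stochastic_kernel K by fact
  interpret prob_space M using mc by (simp add: markov_chain_def)
  have [measurable]: "X n \<in> measurable M (count_space UNIV)" for n
    using mc by (simp add: markov_chain_def)
  define A where "A k s = {\<omega> \<in> space M. \<forall>i\<le>k. X i \<omega> = s i}" for k and s :: "nat \<Rightarrow> 'a"
  define E where "E k s n = {\<omega> \<in> space M. (\<forall>i\<le>k. X i \<omega> = s i) \<and> X (k + n) \<omega> = y}"
    for k n and s :: "nat \<Rightarrow> 'a"
  have [measurable]: "A k s \<in> sets M" "E k s n \<in> sets M" for k s n
    unfolding A_def E_def by measurable
  have prob_A: "prob (A k s) = (if s 0 = x then 1 else 0) * (\<Prod>i<k. K (s i) (s (Suc i)))" for k s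
    using mc by (simp add: markov_chain_def A_def)
  have "prob (E k s n) = prob (A k s) * kernel_pow K n (s k) y" for k s
  proof (induction n arbitrary: k s)
    case 0
    have "E k s 0 = (if s k = y then A k s else {})" by (auto simp: E_def A_def)
    then show ?case by (simp add: kernel_pow_0)
  next
    case (Suc n)
    let ?S = "{z. K (s k) z \<noteq> 0}"
    define t where "t z = s(Suc k := z)" for z
    have step: "prob (A (Suc k) (t z)) = prob (A k s) * K (s k) z" for z
      unfolding prob_A by (simp add: t_def)
    have t_iff: "(\<forall>i\<le>Suc k. X i \<omega> = t z i) \<longleftrightarrow> (\<forall>i\<le>k. X i \<omega> = s i) \<and> X (Suc k) \<omega> = z" for \<omega> z
      by (auto simp: t_def le_Suc_eq)
    have disj: "disjoint_family_on (\<lambda>z. A (Suc k) (t z)) ?S"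
      "disjoint_family_on (\<lambda>z. E (Suc k) (t z) n) ?S"
      by (auto simp: disjoint_family_on_def A_def E_def t_iff)
    \<comment> \<open>Almost surely the chain only makes steps of positive probability.\<close>
    have "prob (\<Union>z\<in>?S. A (Suc k) (t z)) = (\<Sum>z\<in>?S. prob (A k s) * K (s k) z)"
      using finite_range disj by (subst finite_measure_finite_Union) (auto simp: step)
    also have "\<dots> = prob (A k s)" by (simp add: row_sum flip: sum_distrib_left)
    finally have "prob (\<Union>z\<in>?S. A (Suc k) (t z)) = prob (A k s)" .
    moreover have "(\<Union>z\<in>?S. A (Suc k) (t z)) \<subseteq> A k s" by (auto simp: A_def t_iff)
    ultimately have null: "prob (A k s - (\<Union>z\<in>?S. A (Suc k) (t z))) = 0"
      using finite_range by (subst finite_measure_Diff) auto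
    have sub: "(\<Union>z\<in>?S. E (Suc k) (t z) n) \<subseteq> E k s (Suc n)"
      by (auto simp: E_def t_iff)
    have "E k s (Suc n) - (\<Union>z\<in>?S. E (Suc k) (t z) n) \<subseteq> A k s - (\<Union>z\<in>?S. A (Suc k) (t z))"
      by (auto simp: E_def A_def t_iff)
    moreover have "A k s - (\<Union>z\<in>?S. A (Suc k) (t z)) \<in> sets M"
      using finite_range by (intro sets.Diff sets.finite_UN) auto
    ultimately have "prob (E k s (Suc n) - (\<Union>z\<in>?S. E (Suc k) (t z) n)) = 0"
      using null finite_measure_mono measure_nonneg order_antisym by metis
    then have "prob (E k s (Suc n)) = prob (\<Union>z\<in>?S. E (Suc k) (t z) n)"
      using sub finite_range by (subst (asm) finite_measure_Diff) auto
    also have "\<dots> = (\<Sum>z\<in>?S. prob (E (Suc k) (t z) n))"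
      using finite_range disj by (subst finite_measure_finite_Union) auto
    also have "\<dots> = (\<Sum>z\<in>?S. prob (A k s) * (K (s k) z * kernel_pow K n z y))"
      by (simp add: Suc step) (simp add: t_def mult.assoc)
    finally show ?case by (simp add: kernel_pow_Suc flip: sum_distrib_left)
  qed
  note main = this
  have one: "prob (A 0 (\<lambda>_. x)) = 1" by (simp add: prob_A)
  have "prob {\<omega> \<in> space M. X n \<omega> = y} = prob (E 0 (\<lambda>_. x) n)"
  proof (rule measure_eq_AE)
    have "AE \<omega> in M. \<omega> \<in> A 0 (\<lambda>_. x)" using one by (subst (asm) prob_eq_1) auto
    then show "AE \<omega> in M. \<omega> \<in> {\<omega> \<in> space M. X n \<omega> = y} \<longleftrightarrow> \<omega> \<in> E 0 (\<lambda>_. x) n"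
      by eventually_elim (auto simp: A_def E_def)
  qed auto
  then show ?thesis unfolding main one by simp
qed

section \<open>The lamplighter walk\<close>

text \<open>Lamp configurations that differ at most in \<open>A\<close>.\<close>

definition agree_off :: "'v set \<Rightarrow> ('v \<Rightarrow>\<^sub>0 bit) \<Rightarrow> ('v \<Rightarrow>\<^sub>0 bit) \<Rightarrow> bool" where
  "agree_off A f g \<longleftrightarrow> (\<forall>v. v \<notin> A \<longrightarrow> Poly_Mapping.lookup f v = Poly_Mapping.lookup g v)"

text \<open>The kernel that replaces the lamps in \<open>A\<close> by independent fair coin flips.\<close>

definition randomize :: "'v set \<Rightarrow> ('v \<Rightarrow>\<^sub>0 bit) \<Rightarrow> ('v \<Rightarrow>\<^sub>0 bit) \<Rightarrow> real" where
  "randomize A f g = (if agree_off A f g then (1 / 2) ^ card A else 0)"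

lemma bij_betw_agree_off_Pow:
  assumes "finite A"
  shows "bij_betw (\<lambda>g. {v. Poly_Mapping.lookup g v \<noteq> Poly_Mapping.lookup f v})
    {g. agree_off A f g} (Pow A)"
  unfolding bij_betw_def
proof
  have bit_cases: "a \<noteq> c \<longleftrightarrow> b \<noteq> c \<Longrightarrow> a = b" for a b c :: bit
    by (cases a; cases b; cases c) auto
  show "inj_on (\<lambda>g. {v. Poly_Mapping.lookup g v \<noteq> Poly_Mapping.lookup f v}) {g. agree_off A f g}"
  proof (rule inj_onI)
    fix g h
    assume "{v. Poly_Mapping.lookup g v \<noteq> Poly_Mapping.lookup f v}
      = {v. Poly_Mapping.lookup h v \<noteq> Poly_Mapping.lookup f v}"
    then have "Poly_Mapping.lookup g v = Poly_Mapping.lookup h v" for v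
      by (intro bit_cases[of _ "Poly_Mapping.lookup f v"]) blast
    then show "g = h" by (rule poly_mapping_eqI)
  qed
  show "(\<lambda>g. {v. Poly_Mapping.lookup g v \<noteq> Poly_Mapping.lookup f v}) ` {g. agree_off A f g} = Pow A"
  proof (intro equalityI subsetI)
    fix T assume T: "T \<in> Pow A"
    define u where "u v = (if v \<in> T then Poly_Mapping.lookup f v + 1 else Poly_Mapping.lookup f v)" for v
    have "finite {v. u v \<noteq> 0}"
      by (rule finite_subset[of _ "A \<union> Poly_Mapping.keys f"])
        (use T assms in \<open>auto simp: u_def in_keys_iff split: if_splits\<close>)
    then have u: "Poly_Mapping.lookup (Abs_poly_mapping u) = u" by (simp add: Abs_poly_mapping_inverse)
    show "T \<in> (\<lambda>g. {v. Poly_Mapping.lookup g v \<noteq> Poly_Mapping.lookup f v}) ` {g. agree_off A f g}"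
      by (rule image_eqI[of _ _ "Abs_poly_mapping u"]) (use T in \<open>auto simp: u u_def agree_off_def\<close>)
  qed (auto simp: agree_off_def)
qed

lemma finite_agree_off: "finite A \<Longrightarrow> finite {g. agree_off A f g}"
  using bij_betw_finite[OF bij_betw_agree_off_Pow, of A f] by simp

lemma card_agree_off: "finite A \<Longrightarrow> card {g. agree_off A f g} = 2 ^ card A"
  using bij_betw_same_card[OF bij_betw_agree_off_Pow, of A f] by (simp add: card_Pow)

text \<open>Randomizing the lamps in \<open>A\<close> and then those in \<open>B\<close> randomizes those in \<open>A \<union> B\<close>: if \<open>f\<close> and \<open>g\<close>
  agree off \<open>A \<union> B\<close>, the intermediate configurations are free exactly on \<open>A \<inter> B\<close>.\<close>

lemma randomize_comp:
  assumes "finite A" "finite B"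
  shows "(\<Sum>h | agree_off A f h. randomize A f h * randomize B h g) = randomize (A \<union> B) f g"
proof (cases "agree_off (A \<union> B) f g")
  case True
  \<comment> \<open>\<open>u\<close> is one intermediate configuration; the others differ from it on \<open>A \<inter> B\<close>.\<close>
  define u where "u v = (if v \<in> A then Poly_Mapping.lookup g v else Poly_Mapping.lookup f v)" for v
  have "finite {v. u v \<noteq> 0}"
    by (rule finite_subset[of _ "A \<union> Poly_Mapping.keys f"])
      (use assms in \<open>auto simp: u_def in_keys_iff split: if_splits\<close>)
  then have u: "Poly_Mapping.lookup (Abs_poly_mapping u) = u" by (simp add: Abs_poly_mapping_inverse)
  have *: "agree_off A f h \<and> agree_off B h g \<longleftrightarrow> agree_off (A \<inter> B) (Abs_poly_mapping u) h" for h
    using True unfolding agree_off_def u u_def by (metis IntD1 IntD2 IntI UnE)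
  have "(\<Sum>h | agree_off A f h. randomize A f h * randomize B h g)
      = (\<Sum>h | agree_off (A \<inter> B) (Abs_poly_mapping u) h. (1 / 2) ^ card A * (1 / 2) ^ card B)"
    using assms(1)
    by (intro sum.mono_neutral_cong_right) (use * in \<open>auto simp: finite_agree_off randomize_def\<close>)
  also have "\<dots> = 2 ^ card (A \<inter> B) * ((1 / 2) ^ card A * (1 / 2) ^ card B)"
    using assms by (simp add: card_agree_off)
  also have "\<dots> = 2 ^ card (A \<inter> B) * (1 / 2) ^ (card (A \<union> B) + card (A \<inter> B))"
    by (simp flip: power_add card_Un_Int[OF assms])
  also have "\<dots> = (1 / 2) ^ card (A \<union> B)"
    by (simp add: power_add power_one_over)
  finally show ?thesis using True by (simp add: randomize_def)
next
  case False
  then have "\<not> (agree_off A f h \<and> agree_off B h g)" for h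
    unfolding agree_off_def by (metis UnCI)
  then have "randomize A f h * randomize B h g = 0" for h
    unfolding randomize_def by auto
  then have "(\<Sum>h | agree_off A f h. randomize A f h * randomize B h g) = 0" by (simp only: sum.neutral_const)
  with False show ?thesis by (simp add: randomize_def[of "A \<union> B"])
qed

lemma sum_randomize:
  assumes "finite A"
  shows "(\<Sum>h | agree_off A f h. randomize A f h) = 1"
proof -
  have "(\<Sum>h | agree_off A f h. randomize A f h) = (\<Sum>h | agree_off A f h. (1 / 2) ^ card A)"
    by (intro sum.cong) (auto simp: randomize_def)
  then show ?thesis using assms by (simp add: card_agree_off power_one_over)
qed

lemma lamplighter_kernel_eq:
  "lamplighter_kernel \<mu> (f, x) (g, y) = trans_prob \<mu> x y * randomize {x, y} f g"
proof -
  have first: "kernel_comp switch_kernel (walk_kernel \<mu>) (f, x) (h, z)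
      = randomize {x} f h * trans_prob \<mu> x z" for h z
  proof -
    have "kernel_comp switch_kernel (walk_kernel \<mu>) (f, x) (h, z) =
        (\<Sum>\<^sub>\<infinity>w\<in>{(h, x)}. switch_kernel (f, x) w * walk_kernel \<mu> w (h, z))"
      unfolding kernel_comp_def by (rule infsum_cong_neutral) (auto split: if_splits)
    then show ?thesis by (auto simp: randomize_def agree_off_def)
  qed
  let ?S = "{h. agree_off {x} f h}"
  have fin: "finite ?S" by (rule finite_agree_off) simp
  have "lamplighter_kernel \<mu> (f, x) (g, y) =
      (\<Sum>\<^sub>\<infinity>w\<in>(\<lambda>h. (h, y)) ` ?S. kernel_comp switch_kernel (walk_kernel \<mu>) (f, x) w * switch_kernel w (g, y))"
    unfolding lamplighter_kernel_def kernel_comp_def[of _ switch_kernel]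
    by (rule infsum_cong_neutral) (auto simp: first randomize_def split: if_splits)
  also have "\<dots> = (\<Sum>h\<in>?S. randomize {x} f h * trans_prob \<mu> x y * randomize {y} h g)"
    using fin by (simp add: sum.reindex inj_on_def first)
      (auto intro!: sum.cong simp: randomize_def agree_off_def)
  also have "\<dots> = trans_prob \<mu> x y * (\<Sum>h\<in>?S. randomize {x} f h * randomize {y} h g)"
    by (simp add: sum_distrib_left mult_ac)
  also have "(\<Sum>h\<in>?S. randomize {x} f h * randomize {y} h g) = randomize {x, y} f g"
    by (subst randomize_comp) (simp_all add: insert_commute)
  finally show ?thesis .
qed

lemma
  assumes "stochastic_kernel (trans_prob \<mu>)"
  shows finite_range_lamplighter_kernel: "finite {w. lamplighter_kernel \<mu> (f, x) w \<noteq> 0}"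
    and sum_lamplighter_kernel:
      "(\<Sum>w | lamplighter_kernel \<mu> (f, x) w \<noteq> 0. lamplighter_kernel \<mu> (f, x) w * F w) =
       (\<Sum>z | trans_prob \<mu> x z \<noteq> 0. trans_prob \<mu> x z *
          (\<Sum>h | agree_off {x, z} f h. randomize {x, z} f h * F (h, z)))"
proof -
  interpret stochastic_kernel "trans_prob \<mu>" by fact
  let ?T = "SIGMA z:{z. trans_prob \<mu> x z \<noteq> 0}. {h. agree_off {x, z} f h}"
  have set_eq: "{w. lamplighter_kernel \<mu> (f, x) w \<noteq> 0} = prod.swap ` ?T"
    by (auto simp: lamplighter_kernel_eq randomize_def image_iff split: if_splits)
  have T: "finite ?T" using finite_range by (intro finite_SigmaI) (simp_all add: finite_agree_off)
  then show "finite {w. lamplighter_kernel \<mu> (f, x) w \<noteq> 0}" by (simp add: set_eq)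
  have "(\<Sum>w | lamplighter_kernel \<mu> (f, x) w \<noteq> 0. lamplighter_kernel \<mu> (f, x) w * F w)
      = (\<Sum>(z, h)\<in>?T. trans_prob \<mu> x z * (randomize {x, z} f h * F (h, z)))"
    unfolding set_eq
    by (subst sum.reindex) (auto simp: lamplighter_kernel_eq mult.assoc intro!: sum.cong)
  also have "\<dots> = (\<Sum>z | trans_prob \<mu> x z \<noteq> 0. \<Sum>h | agree_off {x, z} f h.
      trans_prob \<mu> x z * (randomize {x, z} f h * F (h, z)))"
    using finite_range[of x] by (subst sum.Sigma) (simp_all add: finite_agree_off)
  finally show "(\<Sum>w | lamplighter_kernel \<mu> (f, x) w \<noteq> 0. lamplighter_kernel \<mu> (f, x) w * F w) =
       (\<Sum>z | trans_prob \<mu> x z \<noteq> 0. trans_prob \<mu> x z *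
          (\<Sum>h | agree_off {x, z} f h. randomize {x, z} f h * F (h, z)))"
    by (simp add: sum_distrib_left)
qed

lemma stochastic_kernel_lamplighter:
  assumes "stochastic_kernel (trans_prob \<mu>)"
  shows "stochastic_kernel (lamplighter_kernel \<mu>)"
proof -
  interpret stochastic_kernel "trans_prob \<mu>" by fact
  show ?thesis
  proof
    fix w w' :: "'a wreath"
    obtain f x where w: "w = (f, x)" by force
    obtain g y where w': "w' = (g, y)" by force
    show "finite {z. lamplighter_kernel \<mu> w z \<noteq> 0}"
      unfolding w by (rule finite_range_lamplighter_kernel) fact
    show "0 \<le> lamplighter_kernel \<mu> w w'"
      by (simp add: w w' lamplighter_kernel_eq randomize_def nonneg)
    show "(\<Sum>z | lamplighter_kernel \<mu> w z \<noteq> 0. lamplighter_kernel \<mu> w z) = 1"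
      using sum_lamplighter_kernel[OF assms, where f = f and x = x and F = "\<lambda>_. 1"]
      by (simp add: w sum_randomize row_sum)
  qed
qed

text \<open>After at least one step the visited lamps are independent fair coin flips and the other ones
  are unchanged. At time \<open>0\<close> this fails, because the lamp at the starting point has not been switched
  yet.\<close>

lemma kernel_pow_lamplighter:
  assumes "stochastic_kernel (trans_prob \<mu>)"
  shows "kernel_pow (lamplighter_kernel \<mu>) (Suc n) (f, x) (g, y) =
    path_expectation (trans_prob \<mu>) (Suc n) x
      (\<lambda>l. if last l = y then randomize (set l) f g else 0)"
proof (induction n arbitrary: f x)
  case 0
  interpret stochastic_kernel "trans_prob \<mu>" by fact
  have "kernel_pow (lamplighter_kernel \<mu>) (Suc 0) (f, x) (g, y)
      = lamplighter_kernel \<mu> (f, x) (g, y)"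
    using finite_range_lamplighter_kernel[OF assms]
    by (simp add: kernel_pow_Suc kernel_pow_0 if_distrib cong: if_cong)
  then show ?case
    using finite_range by (simp add: lamplighter_kernel_eq if_distrib cong: if_cong)
next
  case (Suc n)
  let ?p = "trans_prob \<mu>"
  let ?F = "\<lambda>h l. if last l = y then randomize (set l) h g else 0"
  have "(\<Sum>h | agree_off {x, z} f h. randomize {x, z} f h * path_expectation ?p (Suc n) z (?F h))
      = path_expectation ?p (Suc n) z (\<lambda>l. ?F f (x # l))" for z
  proof -
    have "(\<Sum>h | agree_off {x, z} f h. randomize {x, z} f h * path_expectation ?p (Suc n) z (?F h))
        = path_expectation ?p (Suc n) z
            (\<lambda>l. \<Sum>h | agree_off {x, z} f h. randomize {x, z} f h * ?F h l)"
      unfolding path_expectation_sum path_expectation_mult ..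
    also have "\<dots> = path_expectation ?p (Suc n) z (\<lambda>l. ?F f (x # l))"
    proof (rule path_expectation_cong)
      \<comment> \<open>The path from \<open>z\<close> visits \<open>z\<close>, so the first step adds just \<open>x\<close> to the set of switched lamps.\<close>
      fix l assume l: "l \<noteq> []" "hd l = z"
      then have "{x, z} \<union> set l = set (x # l)" by auto
      moreover have "(\<Sum>h | agree_off {x, z} f h. randomize {x, z} f h * randomize (set l) h g)
          = randomize ({x, z} \<union> set l) f g" by (rule randomize_comp) auto
      ultimately show "(\<Sum>h | agree_off {x, z} f h. randomize {x, z} f h * ?F h l) = ?F f (x # l)"
        using l(1) by simp
    qed
    finally show ?thesis .
  qed
  then show ?case
    unfolding kernel_pow_Suc[of _ "Suc n"] sum_lamplighter_kernel[OF assms] Suc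
      path_expectation.simps(2)[of _ "Suc n"]
    by simp
qed

section \<open>The range of a walk\<close>

text \<open>The expectation of \<open>2\<close> to the power minus the number of points that are in \<open>S\<close> or visited by
  time \<open>n\<close>.\<close>

definition range_weight :: "('s \<Rightarrow> 's \<Rightarrow> real) \<Rightarrow> nat \<Rightarrow> 's set \<Rightarrow> 's \<Rightarrow> real" where
  "range_weight K n S x = path_expectation K n x (\<lambda>l. (1 / 2) ^ card (S \<union> set l))"

context stochastic_kernel
begin

lemma range_weight_insert: "range_weight K n (insert x S) x = range_weight K n S x"
  unfolding range_weight_def
proof (rule path_expectation_cong)
  fix l assume "l \<noteq> []" "hd l = x"
  then have "insert x S \<union> set l = S \<union> set l" by auto
  then show "(1 / 2 :: real) ^ card (insert x S \<union> set l) = (1 / 2) ^ card (S \<union> set l)" by simp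
qed

lemma range_weight_le:
  assumes "finite S"
  shows "range_weight K n S x \<le> (1 / 2) ^ card S"
proof -
  have "range_weight K n S x \<le> path_expectation K n x (\<lambda>_. (1 / 2) ^ card S)"
    unfolding range_weight_def using assms
    by (intro path_expectation_mono power_decreasing card_mono) auto
  then show ?thesis by (simp add: path_expectation_const)
qed

text \<open>Dropping the points visited in the first \<open>t\<close> steps.\<close>

lemma range_weight_add_le:
  assumes "finite S"
  shows "range_weight K (t + n) S x \<le> kernel_op K t (range_weight K n S) x"
proof (induction t arbitrary: x)
  case (Suc t)
  have "path_expectation K (t + n) z (\<lambda>l. (1 / 2) ^ card (S \<union> set (x # l)))
      \<le> range_weight K (t + n) S z" for z
    unfolding range_weight_def using assms
    by (intro path_expectation_mono power_decreasing card_mono) auto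
  then have "range_weight K (Suc t + n) S x \<le> (\<Sum>z | K x z \<noteq> 0. K x z * range_weight K (t + n) S z)"
    unfolding range_weight_def[of K "Suc (t + n)"] add_Suc path_expectation.simps
    by (intro sum_kernel_mono)
  also have "\<dots> \<le> (\<Sum>z | K x z \<noteq> 0. K x z * kernel_op K t (range_weight K n S) z)"
    by (intro sum_kernel_mono Suc.IH)
  finally show ?case by simp
qed simp

text \<open>Only the positions at multiples of \<open>t\<close> are recorded. As long as there are at most \<open>M\<close> recorded
  points, the position \<open>t\<close> steps later is a new one with probability at least \<open>1 - \<epsilon> M \<ge> 1 / 2\<close>, and a
  new point halves the weight; so each block multiplies the expectation by at most \<open>3 / 4\<close>. Once
  there are more than \<open>M\<close> recorded points the weight is below \<open>2\<^bsup>-M\<^esup>\<close>.\<close>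

lemma range_weight_blocks_le:
  assumes \<epsilon>: "\<And>x y. kernel_pow K t x y \<le> \<epsilon>" and M: "2 * \<epsilon> * M \<le> 1" and S: "finite S"
  shows "range_weight K (N * t) S x \<le> (3 / 4) ^ N * (1 / 2) ^ card S + 4 * (1 / 2) powr M"
  using S
proof (induction N arbitrary: S x)
  case 0
  have "range_weight K (0 * t) S x \<le> (1 / 2) ^ card S" by (rule range_weight_le[OF 0])
  also have "\<dots> \<le> (3 / 4) ^ 0 * (1 / 2) ^ card S + 4 * (1 / 2) powr M" by simp
  finally show ?case .
next
  case (Suc N)
  show ?case
  proof (cases "real (card S) \<le> M")
    case False
    have "range_weight K (Suc N * t) S x \<le> (1 / 2) ^ card S" by (rule range_weight_le[OF Suc.prems])
    also have "\<dots> = (1 / 2) powr real (card S)" by (simp add: powr_realpow)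
    also have "\<dots> \<le> (1 / 2) powr M" using False by (intro powr_mono') auto
    also have "\<dots> \<le> 4 * (1 / 2) powr M" by simp
    also have "\<dots> \<le> (3 / 4) ^ Suc N * (1 / 2) ^ card S + 4 * (1 / 2) powr M" by simp
    finally show ?thesis .
  next
    case True
    have eps0: "0 \<le> \<epsilon>" using kernel_pow_nonneg \<epsilon> order_trans by blast
    have "range_weight K (Suc N * t) S x \<le> kernel_op K t (range_weight K (N * t) S) x"
      using range_weight_add_le[OF Suc.prems, of t "N * t"] by simp
    also have "\<dots> \<le> kernel_op K t (\<lambda>y. (3 / 4) ^ N * ((1 / 2) ^ card S *
        (1 / 2 + (\<Sum>s\<in>S. 1 / 2 * (if y = s then 1 else 0)))) + 4 * (1 / 2) powr M) x"
    proof (rule kernel_op_mono)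
      fix y
      have "range_weight K (N * t) S y = range_weight K (N * t) (insert y S) y"
        by (simp add: range_weight_insert)
      also have "\<dots> \<le> (3 / 4) ^ N * (1 / 2) ^ card (insert y S) + 4 * (1 / 2) powr M"
        by (rule Suc.IH) (simp add: Suc.prems)
      also have "(1 / 2) ^ card (insert y S) =
          (1 / 2) ^ card S * (1 / 2 + (\<Sum>s\<in>S. 1 / 2 * (if y = s then 1 else 0 :: real)))"
      proof -
        have "(\<Sum>s\<in>S. 1 / 2 * (if y = s then 1 else 0 :: real)) = (if y \<in> S then 1 / 2 else 0)"
          using Suc.prems by (simp add: if_distrib cong: if_cong)
        then show ?thesis using Suc.prems by (simp add: card_insert_if)
      qed
      finally show "range_weight K (N * t) S y \<le> (3 / 4) ^ N * ((1 / 2) ^ card S *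
        (1 / 2 + (\<Sum>s\<in>S. 1 / 2 * (if y = s then 1 else 0)))) + 4 * (1 / 2) powr M" .
    qed
    also have "\<dots> = (3 / 4) ^ N * ((1 / 2) ^ card S *
        (1 / 2 + (\<Sum>s\<in>S. 1 / 2 * kernel_pow K t x s))) + 4 * (1 / 2) powr M"
      by (simp only: kernel_op_add_fun kernel_op_const kernel_op_mult kernel_op_sum kernel_pow_def)
    also have "\<dots> \<le> (3 / 4) ^ N * ((1 / 2) ^ card S * (3 / 4)) + 4 * (1 / 2) powr M"
    proof -
      have "(\<Sum>s\<in>S. 1 / 2 * kernel_pow K t x s) \<le> (\<Sum>s\<in>S. 1 / 2 * \<epsilon>)"
        using \<epsilon> by (intro sum_mono mult_left_mono) auto
      also have "\<dots> = \<epsilon> * real (card S) / 2" by simp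
      also have "\<dots> \<le> \<epsilon> * M / 2"
        using True eps0 by (intro divide_right_mono mult_left_mono) auto
      also have "\<dots> \<le> 1 / 4" using M by (simp add: mult_ac)
      finally have "1 / 2 + (\<Sum>s\<in>S. 1 / 2 * kernel_pow K t x s) \<le> 3 / 4" by simp
      then show ?thesis by (intro add_right_mono mult_left_mono) auto
    qed
    finally show ?thesis by (simp add: mult_ac)
  qed
qed

lemma range_weight_add_le_bound:
  assumes "\<And>y. range_weight K n S y \<le> b" "finite S"
  shows "range_weight K (t + n) S x \<le> b"
proof -
  have "range_weight K (t + n) S x \<le> kernel_op K t (range_weight K n S) x"
    by (rule range_weight_add_le[OF assms(2)])
  also have "\<dots> \<le> kernel_op K t (\<lambda>_. b) x" by (rule kernel_op_mono[OF assms(1)])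
  finally show ?thesis by (simp add: kernel_op_const)
qed

end

lemma kernel_pow_lamplighter_le_range_weight:
  assumes "stochastic_kernel (trans_prob \<mu>)" "n \<ge> 1"
  shows "kernel_pow (lamplighter_kernel \<mu>) n (f, x) (g, y) \<le> range_weight (trans_prob \<mu>) n {} x"
proof -
  interpret stochastic_kernel "trans_prob \<mu>" by fact
  obtain k where n: "n = Suc k" using assms(2) by (cases n) auto
  show ?thesis
    unfolding n kernel_pow_lamplighter[OF assms(1)] range_weight_def
    by (rule path_expectation_mono) (simp add: randomize_def)
qed

text \<open>The walker returns with all lamps as at the start if it comes back without leaving \<open>B\<close> and all
  the coin flips for the lamps visited come out right.\<close>

lemma kernel_pow_lamplighter_ge_killed:
  assumes "stochastic_kernel (trans_prob \<mu>)" "n \<ge> 1" "finite B" "x \<in> B"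
  shows "(1 / 2) ^ card B * kernel_pow (killed B (trans_prob \<mu>)) n x x
    \<le> kernel_pow (lamplighter_kernel \<mu>) n (f, x) (f, x)"
proof -
  interpret stochastic_kernel "trans_prob \<mu>" by fact
  obtain k where n: "n = Suc k" using assms(2) by (cases n) auto
  have "(1 / 2) ^ card B * kernel_pow (killed B (trans_prob \<mu>)) n x x
      \<le> (1 / 2) ^ card B * path_expectation (trans_prob \<mu>) n x
          (\<lambda>l. if last l = x \<and> set l \<subseteq> B then 1 else 0)"
    by (intro mult_left_mono kernel_pow_killed_le_path_expectation assms) auto
  also have "\<dots> = path_expectation (trans_prob \<mu>) n x
      (\<lambda>l. (1 / 2) ^ card B * (if last l = x \<and> set l \<subseteq> B then 1 else 0))"
    by (simp only: path_expectation_mult)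
  also have "\<dots> \<le> kernel_pow (lamplighter_kernel \<mu>) n (f, x) (f, x)"
    unfolding n kernel_pow_lamplighter[OF assms(1)]
    by (rule path_expectation_mono)
      (use \<open>finite B\<close> in \<open>auto simp: randomize_def agree_off_def intro!: power_decreasing card_mono\<close>)
  finally show ?thesis .
qed

section \<open>Return probabilities from heat kernel bounds\<close>

lemma powr_mult_exp_powr_le:
  fixes a b c s :: real
  assumes "0 < a" "0 < b" "0 < c" "0 < s"
  shows "s powr a * exp (- c * s powr b) \<le> exp (a / b * (ln (a / b) - 1 - ln c))"
proof -
  define q where "q = a / b"
  define t where "t = c * s powr b"
  have q: "0 < q" and t: "0 < t" using assms by (auto simp: q_def t_def)
  have "ln (t / q) \<le> t / q - 1" using q t by (intro ln_le_minus_one) simp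
  then have "q * ln (t / q) \<le> q * (t / q - 1)" using q by (intro mult_left_mono) auto
  then have "q * (ln t - ln q) \<le> t - q" using q t by (simp add: ln_div algebra_simps)
  moreover have "a * ln s = q * (ln t - ln c)"
    using assms by (simp add: t_def q_def ln_mult ln_powr)
  ultimately have "a * ln s - t \<le> q * (ln q - 1 - ln c)" by (simp add: algebra_simps)
  moreover have "s powr a * exp (- c * s powr b) = exp (a * ln s - t)"
    using assms by (simp add: powr_def t_def exp_diff exp_minus field_simps)
  ultimately show ?thesis by (simp add: q_def)
qed

text \<open>The scale \<open>k \<approx> n\<^bsup>\<theta>\<^esup>\<close> of the time blocks.\<close>

lemma nat_ceiling_powr_bounds:
  fixes n :: nat and \<theta> :: real
  assumes "n \<ge> 1" "0 \<le> \<theta>" "\<theta> \<le> 1"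
  defines "k \<equiv> nat \<lceil>real n powr \<theta>\<rceil>"
  shows "1 \<le> k" "k \<le> n" "real n powr \<theta> \<le> real k" "real k \<le> 2 * real n powr \<theta>"
proof -
  have one: "1 \<le> real n powr \<theta>" using assms by (simp add: ge_one_powr_ge_zero)
  have "real n powr \<theta> \<le> real n powr 1" using assms by (intro powr_mono) auto
  then have n: "real n powr \<theta> \<le> real n" by simp
  show ge: "real n powr \<theta> \<le> real k" unfolding k_def by linarith
  show "1 \<le> k" using ge one by linarith
  show "k \<le> n" using n unfolding k_def by linarith
  show "real k \<le> 2 * real n powr \<theta>" using one unfolding k_def by linarith
qed

text \<open>What the two estimates use of the graph: heat kernel bounds in terms of powers of the time, and
  a bound for the number of points of a ball. Off the diagonal, the distance between \<open>x\<close> and \<open>y\<close>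
  enters only through a ball about \<open>x\<close> that does not contain \<open>y\<close>.\<close>

locale heat_kernel_bounds =
  stochastic_kernel "trans_prob \<mu>" + reversible_kernel "trans_prob \<mu>" m
  for \<mu> :: "'v \<Rightarrow> 'v \<Rightarrow> real" and m :: "'v \<Rightarrow> real" +
  fixes ball :: "'v \<Rightarrow> real \<Rightarrow> 'v set"
    and d\<^sub>f d\<^sub>w a b C c C' D :: real
  assumes exponents: "0 < d\<^sub>f" "1 < d\<^sub>w"
    and constants: "0 < a" "0 < b" "0 < C" "0 < c" "0 < C'" "0 < D"
    and weight_bounds: "a \<le> m x" "m x \<le> b"
    and center_in_ball: "r \<ge> 1 \<Longrightarrow> x \<in> ball x r"
    and finite_ball: "r \<ge> 1 \<Longrightarrow> finite (ball x r)"
    and card_ball: "r \<ge> 1 \<Longrightarrow> real (card (ball x r)) \<le> D * r powr d\<^sub>f"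
    and diagonal_upper:
      "n \<ge> 1 \<Longrightarrow> kernel_pow (trans_prob \<mu>) n x y \<le> C * real n powr - (d\<^sub>f / d\<^sub>w)"
    and off_diagonal_upper:
      "n \<ge> 1 \<Longrightarrow> r \<ge> 1 \<Longrightarrow> y \<notin> ball x r \<Longrightarrow> kernel_pow (trans_prob \<mu>) n x y \<le>
        C * real n powr - (d\<^sub>f / d\<^sub>w) * exp (- c * (r powr d\<^sub>w / real n) powr (1 / (d\<^sub>w - 1)))"
    and diagonal_lower:
      "n \<ge> 1 \<Longrightarrow> kernel_pow (trans_prob \<mu>) n x x + kernel_pow (trans_prob \<mu>) (n + 1) x x
        \<ge> C' * real n powr - (d\<^sub>f / d\<^sub>w)"
begin

abbreviation "\<gamma> \<equiv> d\<^sub>f / d\<^sub>w"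
abbreviation "\<alpha> \<equiv> d\<^sub>f / (d\<^sub>f + d\<^sub>w)"
abbreviation "\<theta> \<equiv> d\<^sub>w / (d\<^sub>f + d\<^sub>w)"

lemma exponent_facts: "0 < \<gamma>" "0 < \<alpha>" "0 < \<theta>" "\<theta> < 1" "\<theta> * \<gamma> = \<alpha>" "1 - \<theta> = \<alpha>"
  using exponents by (auto simp: field_simps)

text \<open>By log-convexity \<open>p\<^bsub>2k+1\<^esub>\<^sup>2 \<le> p\<^bsub>2k\<^esub> p\<^bsub>2k+2\<^esub>\<close>, so the lower bound for \<open>p\<^bsub>2k\<^esub> + p\<^bsub>2k+1\<^esub>\<close> on the
  diagonal is already carried by the even term.\<close>

lemma even_diagonal_lower:
  "\<exists>c0>0. \<forall>k\<ge>1. \<forall>x. c0 * real k powr - \<gamma> \<le> kernel_pow (trans_prob \<mu>) (2 * k) x x"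
proof (intro exI conjI allI impI)
  let ?t = "C / C'"
  show "0 < C' / (2 + ?t) * 2 powr - \<gamma>" using constants by (auto intro!: divide_pos_pos add_pos_pos)
  fix k :: nat and x assume k: "k \<ge> 1"
  define P Q L where "P = kernel_pow (trans_prob \<mu>) (2 * k) x x"
    and "Q = kernel_pow (trans_prob \<mu>) (2 * k + 1) x x" and "L = C' * (2 * real k) powr - \<gamma>"
  have nonneg: "0 \<le> P" "0 \<le> Q" "0 \<le> L" "0 < ?t"
    using constants by (auto simp: P_def Q_def L_def kernel_pow_nonneg)
  have "L \<le> P + Q" using diagonal_lower[of "2 * k" x] k by (simp add: L_def P_def Q_def)
  have "kernel_pow (trans_prob \<mu>) (2 * (k + 1)) x x \<le> C * real (2 * (k + 1)) powr - \<gamma>"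
    by (rule diagonal_upper) simp
  also have "\<dots> \<le> C * (2 * real k) powr - \<gamma>"
    using k exponent_facts constants by (intro mult_left_mono powr_mono2') auto
  also have "\<dots> = ?t * L" using constants by (simp add: L_def)
  finally have "P * kernel_pow (trans_prob \<mu>) (2 * (k + 1)) x x \<le> P * (?t * L)"
    using nonneg by (intro mult_left_mono)
  moreover have "Q\<^sup>2 \<le> P * kernel_pow (trans_prob \<mu>) (2 * (k + 1)) x x"
    using kernel_pow_log_convex[of k "k + 1" x] by (simp add: P_def Q_def mult_2)
  ultimately have "Q\<^sup>2 \<le> (?t * P) * L" by (simp add: mult_ac)
  moreover have "4 * (u * L) \<le> (u + L)\<^sup>2" for u
    using zero_le_power2[of "u - L"] by (simp add: power2_eq_square algebra_simps)
  ultimately have "4 * Q\<^sup>2 \<le> (?t * P + L)\<^sup>2" by (meson mult_left_mono order_trans zero_le_numeral)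
  then have "(2 * Q)\<^sup>2 \<le> (?t * P + L)\<^sup>2" by (simp add: power_mult_distrib)
  moreover have "0 \<le> ?t * P + L" using nonneg by (intro add_nonneg_nonneg mult_nonneg_nonneg) auto
  ultimately have "2 * Q \<le> ?t * P + L" by (rule power2_le_imp_le)
  with \<open>L \<le> P + Q\<close> have "L \<le> (2 + ?t) * P" by (simp add: algebra_simps)
  then have "L / (2 + ?t) \<le> P" using nonneg by (simp add: pos_divide_le_eq mult.commute)
  then show "C' / (2 + ?t) * 2 powr - \<gamma> * real k powr - \<gamma> \<le> P"
    by (simp add: L_def powr_mult mult_ac)
qed

text \<open>The walk killed outside a ball of radius \<open>A k\<^bsup>1/d\<^sub>w\<^esup>\<close> still has diagonal lower bounds of the same
  order at times comparable to \<open>k\<close>: at any given time the probability that a walk started outside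
  the ball is at the centre is at most a small multiple of \<open>k\<^bsup>-\<gamma>\<^esup>\<close>.\<close>

lemma killed_even_diagonal_lower:
  "\<exists>A\<ge>1. \<exists>c1>0. \<forall>k\<ge>1. \<forall>j x. k \<le> j \<longrightarrow> j \<le> 3 * k \<longrightarrow>
    c1 * real k powr - \<gamma>
      \<le> kernel_pow (killed (ball x (A * real k powr (1 / d\<^sub>w))) (trans_prob \<mu>)) (2 * j) x x"
proof -
  obtain c0 where c0: "0 < c0"
    "\<And>k x. k \<ge> 1 \<Longrightarrow> c0 * real k powr - \<gamma> \<le> kernel_pow (trans_prob \<mu>) (2 * k) x x"
    using even_diagonal_lower by blast
  define c1 where "c1 = c0 * 3 powr - \<gamma> / 2"
  define \<delta> where "\<delta> = 1 / (d\<^sub>w - 1)"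
  define H where "H = exp (\<gamma> / \<delta> * (ln (\<gamma> / \<delta>) - 1 - ln c))"
  define G where "G = b / a * C * H"
  define A where "A = max 1 ((G / c1) powr (1 / d\<^sub>f))"
  have pos: "0 < c1" "0 < G" "0 < H" "0 < \<delta>"
    using c0 constants exponents by (auto simp: c1_def G_def H_def \<delta>_def)
  have A1: "1 \<le> A" by (simp add: A_def)
  have "G / c1 = ((G / c1) powr (1 / d\<^sub>f)) powr d\<^sub>f"
    using pos exponents by (simp add: powr_powr)
  also have "\<dots> \<le> A powr d\<^sub>f" using exponents by (intro powr_mono2) (auto simp: A_def)
  finally have A: "G * A powr - d\<^sub>f \<le> c1" using pos A1 by (simp add: powr_minus field_simps)
  have "c1 * real k powr - \<gamma>
      \<le> kernel_pow (killed (ball x (A * real k powr (1 / d\<^sub>w))) (trans_prob \<mu>)) (2 * j) x x"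
    if k: "k \<ge> 1" and j: "k \<le> j" "j \<le> 3 * k" for k j :: nat and x
  proof -
    define R where "R = A * real k powr (1 / d\<^sub>w)"
    have "1 \<le> real k powr (1 / d\<^sub>w)" using k exponents by (intro ge_one_powr_ge_zero) auto
    then have R1: "1 \<le> R" using A1 mult_mono[of 1 A 1 "real k powr (1 / d\<^sub>w)"] by (simp add: R_def)
    have R_df: "R powr - d\<^sub>f = A powr - d\<^sub>f * real k powr - \<gamma>"
      using A1 exponents by (simp add: R_def powr_mult powr_powr)
    \<comment> \<open>In terms of \<open>s = R\<^bsup>d\<^sub>w\<^esup> / i\<close> the off-diagonal bound is \<open>R\<^bsup>-d\<^sub>f\<^esup>\<close> times a bounded function of \<open>s\<close>,
      so it is uniform in the time \<open>i\<close>.\<close>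
    have far: "kernel_pow (trans_prob \<mu>) i w x \<le> c1 * real k powr - \<gamma>" if w: "w \<notin> ball x R" for i w
    proof (cases "i = 0")
      case True
      have "w \<noteq> x" using w center_in_ball[OF R1] by blast
      then show ?thesis using True pos by (simp add: kernel_pow_0)
    next
      case False
      define s where "s = R powr d\<^sub>w / real i"
      have s: "0 < s" using False R1 by (simp add: s_def)
      have m: "0 < m w" "0 < m x" by (rule weight_pos)+
      have "kernel_pow (trans_prob \<mu>) i w x = m x / m w * kernel_pow (trans_prob \<mu>) i x w"
        using kernel_pow_reversible[of w i x] m by (simp add: field_simps)
      also have "\<dots> \<le> b / a * kernel_pow (trans_prob \<mu>) i x w"
        using weight_bounds[of x] weight_bounds[of w] m constants
        by (intro mult_right_mono frac_le) (auto simp: kernel_pow_nonneg)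
      also have "\<dots> \<le> b / a * (C * real i powr - \<gamma> * exp (- c * s powr \<delta>))"
        unfolding s_def \<delta>_def using False w R1 constants
        by (intro mult_left_mono off_diagonal_upper) auto
      also have "real i powr - \<gamma> = s powr \<gamma> * R powr - d\<^sub>f"
        using False R1 exponents by (simp add: s_def powr_divide powr_powr powr_minus field_simps)
      also have "b / a * (C * (s powr \<gamma> * R powr - d\<^sub>f) * exp (- c * s powr \<delta>)) =
          b / a * C * R powr - d\<^sub>f * (s powr \<gamma> * exp (- c * s powr \<delta>))" by (simp only: mult_ac)
      also have "\<dots> \<le> b / a * C * R powr - d\<^sub>f * H"
        unfolding H_def using constants exponent_facts s pos
        by (intro mult_left_mono powr_mult_exp_powr_le) auto
      also have "\<dots> = (G * A powr - d\<^sub>f) * real k powr - \<gamma>"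
        by (simp add: R_df G_def mult_ac)
      also have "\<dots> \<le> c1 * real k powr - \<gamma>" using A by (intro mult_right_mono) auto
      finally show ?thesis .
    qed
    have "2 * c1 * real k powr - \<gamma> = c0 * (3 * real k) powr - \<gamma>"
      by (simp add: c1_def powr_mult)
    also have "\<dots> \<le> c0 * real j powr - \<gamma>"
      using c0 k j exponent_facts by (intro mult_left_mono powr_mono2') auto
    also have "\<dots> \<le> kernel_pow (trans_prob \<mu>) (2 * j) x x" using k j by (intro c0(2)) auto
    also have "\<dots> \<le> kernel_pow (killed (ball x R) (trans_prob \<mu>)) (2 * j) x x + c1 * real k powr - \<gamma>"
      by (rule kernel_pow_le_killed) (use far pos center_in_ball[OF R1] in auto)
    finally show ?thesis by (simp add: R_def)
  qed
  then show ?thesis using A1 pos by blast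
qed

text \<open>The ball has at most \<open>F n\<^bsup>\<alpha>\<^esup>\<close> points, and each of the at most \<open>n\<^bsup>\<alpha>\<^esup>\<close> blocks of time costs a factor
  \<open>\<rho>\<close>. The prefactor \<open>k\<^bsup>-\<gamma>\<^esup>\<close> is of order \<open>n\<^bsup>-\<alpha>\<^esup>\<close> and is absorbed by \<open>n\<^bsup>\<alpha>\<^esup> \<le> exp (n\<^bsup>\<alpha>\<^esup>)\<close>.\<close>

lemma lamplighter_return_lower:
  "\<exists>c2>0. \<exists>d>0. \<forall>n\<ge>1. \<forall>f x. c2 * exp (- d * real n powr \<alpha>)
    \<le> kernel_pow (lamplighter_kernel \<mu>) (2 * n) (f, x) (f, x)"
proof -
  obtain A c1 where A: "A \<ge> 1" and c1: "c1 > 0" and killed: "\<And>k j x. k \<ge> 1 \<Longrightarrow> k \<le> j \<Longrightarrow> j \<le> 3 * k \<Longrightarrow>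
    c1 * real k powr - \<gamma>
      \<le> kernel_pow (killed (ball x (A * real k powr (1 / d\<^sub>w))) (trans_prob \<mu>)) (2 * j) x x"
    using killed_even_diagonal_lower by blast
  define \<rho> where "\<rho> = min 1 (c1 / C)"
  define F where "F = D * A powr d\<^sub>f * 2 powr \<gamma>"
  define d where "d = 1 - ln \<rho> + ln 2 * F"
  have \<rho>: "0 < \<rho>" "\<rho> \<le> 1" using c1 constants by (auto simp: \<rho>_def)
  have F: "0 < F" using constants A by (simp add: F_def)
  have "ln \<rho> \<le> 0" using \<rho> by simp
  then have d: "0 < d" using F unfolding d_def by (intro add_pos_pos) auto
  have "c1 * 2 powr - \<gamma> * exp (- d * real n powr \<alpha>)
      \<le> kernel_pow (lamplighter_kernel \<mu>) (2 * n) (f, x) (f, x)" if n: "n \<ge> 1" for n f x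
  proof -
    define k where "k = nat \<lceil>real n powr \<theta>\<rceil>"
    have k: "1 \<le> k" "k \<le> n" "real n powr \<theta> \<le> real k" "real k \<le> 2 * real n powr \<theta>"
      using nat_ceiling_powr_bounds[OF n, of \<theta>] exponent_facts by (auto simp: k_def)
    define R where "R = A * real k powr (1 / d\<^sub>w)"
    have "1 \<le> real k powr (1 / d\<^sub>w)" using k exponents by (intro ge_one_powr_ge_zero) auto
    then have R1: "1 \<le> R" using A mult_mono[of 1 A 1 "real k powr (1 / d\<^sub>w)"] by (simp add: R_def)
    define N where "N = real n powr \<alpha>"
    have k_\<gamma>: "real k powr \<gamma> \<le> 2 powr \<gamma> * N"
    proof -
      have "real k powr \<gamma> \<le> (2 * real n powr \<theta>) powr \<gamma>"
        using k exponent_facts by (intro powr_mono2) auto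
      also have "\<dots> = 2 powr \<gamma> * N" using exponents by (simp add: N_def powr_mult powr_powr)
      finally show ?thesis .
    qed
    have N: "0 < N" using n by (simp add: N_def)
    have "real (card (ball x R)) \<le> D * R powr d\<^sub>f" by (rule card_ball[OF R1])
    also have "R powr d\<^sub>f = A powr d\<^sub>f * real k powr \<gamma>"
      using A exponents by (simp add: R_def powr_mult powr_powr)
    also have "D * (A powr d\<^sub>f * real k powr \<gamma>) \<le> D * (A powr d\<^sub>f * (2 powr \<gamma> * N))"
      using constants k_\<gamma> by (intro mult_left_mono) auto
    also have "\<dots> = F * N" by (simp add: F_def)
    finally have card: "real (card (ball x R)) \<le> F * N" .
    have lamps: "exp (- (ln 2 * F) * N) \<le> (1 / 2) ^ card (ball x R)"
    proof -
      have "(1 / 2 :: real) ^ card (ball x R) = exp (- (ln 2 * real (card (ball x R))))"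
        by (simp add: exp_minus exp_of_nat2_mult power_one_over inverse_eq_divide)
      moreover have "ln 2 * real (card (ball x R)) \<le> ln 2 * (F * N)"
        using card by (intro mult_left_mono) auto
      ultimately show ?thesis by simp
    qed
    \<comment> \<open>Starting from \<open>s \<in> [k, 2 k]\<close> instead of the remainder of \<open>n\<close> modulo \<open>k\<close> keeps \<open>s\<close> and \<open>s + k\<close> in
      the range where the diagonal bounds for the killed walk hold.\<close>
    define s i where "s = k + n mod k" and "i = n div k - 1"
    have "1 \<le> n div k" using k by (simp add: Suc_le_eq div_greater_zero_iff)
    then have "s + i * k = k * (n div k) + n mod k"
      using k by (simp add: s_def i_def algebra_simps)
    then have n_eq: "s + i * k = n" by simp
    have s: "k \<le> s" "s \<le> 2 * k" using k mod_less_divisor[of k n] by (auto simp: s_def)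
    have i: "real i \<le> N"
    proof -
      have "real i * real k \<le> real n" unfolding n_eq[symmetric] by simp
      then have "real i \<le> real n / real k" using k by (simp add: pos_le_divide_eq)
      also have "\<dots> \<le> real n / real n powr \<theta>" using k n by (intro divide_left_mono) auto
      also have "\<dots> = real n powr (1 - \<theta>)" using n by (simp add: powr_diff)
      finally show ?thesis by (simp add: exponent_facts N_def)
    qed
    interpret kill: reversible_kernel "killed (ball x R) (trans_prob \<mu>)" m
      by (rule reversible_kernel_killed)
    let ?q = "\<lambda>j. kernel_pow (killed (ball x R) (trans_prob \<mu>)) (2 * j) x x"
    let ?l = "c1 * real k powr - \<gamma>" and ?u = "C * real k powr - \<gamma>"
    have l: "0 < ?l" using c1 k by simp
    have "?q s \<le> kernel_pow (trans_prob \<mu>) (2 * s) x x" by (rule kernel_pow_killed_le)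
    also have "\<dots> \<le> C * real (2 * s) powr - \<gamma>" using k s by (intro diagonal_upper) linarith
    also have "\<dots> \<le> ?u"
      using k s constants exponent_facts by (intro mult_left_mono powr_mono2') auto
    finally have u: "?q s \<le> ?u" .
    have "?l * (?l / ?u) ^ i \<le> ?q (s + i * k)"
    proof (rule kill.kernel_pow_even_lower_bound[OF l _ _ u])
      show "?l \<le> ?q s" unfolding R_def by (rule killed) (use k s in linarith)+
      show "?l \<le> ?q (s + k)" unfolding R_def by (rule killed) (use k s in linarith)+
    qed
    also have "?l / ?u = c1 / C" using k by simp
    finally have "?l * (c1 / C) ^ i \<le> ?q n" by (simp add: n_eq)
    moreover have "exp (- (1 - ln \<rho>) * N) * (c1 * 2 powr - \<gamma>) \<le> ?l * (c1 / C) ^ i"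
    proof -
      have "exp (ln \<rho> * N) \<le> exp (ln \<rho> * real i)"
        using i \<open>ln \<rho> \<le> 0\<close> by (simp add: mult_left_mono_neg)
      also have "\<dots> = \<rho> ^ i" using \<rho> by (simp add: exp_of_nat2_mult)
      also have "\<dots> \<le> (c1 / C) ^ i" using \<rho> by (intro power_mono) (auto simp: \<rho>_def)
      finally have e1: "exp (ln \<rho> * N) \<le> (c1 / C) ^ i" .
      have "N \<le> exp N" using exp_ge_add_one_self[of N] by linarith
      then have "exp (- N) * 2 powr - \<gamma> \<le> 1 / N * 2 powr - \<gamma>"
        using N by (intro mult_right_mono) (simp_all add: exp_minus field_simps)
      also have "\<dots> = 1 / (2 powr \<gamma> * N)" by (simp add: powr_minus field_simps)
      also have "\<dots> \<le> 1 / real k powr \<gamma>" using k_\<gamma> k N by (intro divide_left_mono) auto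
      also have "\<dots> = real k powr - \<gamma>" by (simp add: powr_minus inverse_eq_divide)
      finally have e2: "exp (- N) * 2 powr - \<gamma> \<le> real k powr - \<gamma>" .
      have "exp (- (1 - ln \<rho>) * N) * (c1 * 2 powr - \<gamma>)
          = c1 * (exp (- N) * 2 powr - \<gamma>) * exp (ln \<rho> * N)"
        by (simp add: algebra_simps exp_diff exp_minus) (simp add: field_simps flip: exp_add)
      also have "\<dots> \<le> c1 * real k powr - \<gamma> * (c1 / C) ^ i"
        using e1 e2 c1 by (intro mult_mono) auto
      finally show ?thesis .
    qed
    ultimately have "exp (- (1 - ln \<rho>) * N) * (c1 * 2 powr - \<gamma>) \<le> ?q n" by linarith
    with lamps have "exp (- (ln 2 * F) * N) * (exp (- (1 - ln \<rho>) * N) * (c1 * 2 powr - \<gamma>))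
        \<le> (1 / 2) ^ card (ball x R) * ?q n"
      using c1 by (intro mult_mono) auto
    also have "\<dots> \<le> kernel_pow (lamplighter_kernel \<mu>) (2 * n) (f, x) (f, x)"
      by (rule kernel_pow_lamplighter_ge_killed)
        (use n in \<open>auto simp: finite_ball center_in_ball R1 stochastic_kernel_axioms\<close>)
    also have "exp (- (ln 2 * F) * N) * (exp (- (1 - ln \<rho>) * N) * (c1 * 2 powr - \<gamma>))
        = c1 * 2 powr - \<gamma> * exp (- d * N)"
      by (simp add: d_def algebra_simps flip: exp_add)
    finally show ?thesis by (simp add: N_def)
  qed
  moreover have "0 < c1 * 2 powr - \<gamma>" using c1 by simp
  ultimately show ?thesis using d by blast
qed

lemma lamplighter_return_upper:
  "\<exists>c3>0. \<exists>d>0. \<forall>n\<ge>1. \<forall>f x. kernel_pow (lamplighter_kernel \<mu>) (2 * n) (f, x) (f, x)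
    \<le> c3 * exp (- d * real n powr \<alpha>)"
proof -
  define d where "d = min (ln (4 / 3)) (ln 2 / (2 * C))"
  have d: "0 < d" using constants by (simp add: d_def)
  have "kernel_pow (lamplighter_kernel \<mu>) (2 * n) (f, x) (f, x) \<le> 6 * exp (- d * real n powr \<alpha>)"
    if n: "n \<ge> 1" for n f x
  proof -
    define t where "t = nat \<lceil>real n powr \<theta>\<rceil>"
    have t: "1 \<le> t" "t \<le> n" "real n powr \<theta> \<le> real t" "real t \<le> 2 * real n powr \<theta>"
      using nat_ceiling_powr_bounds[OF n, of \<theta>] exponent_facts by (auto simp: t_def)
    define N where "N = real n powr \<alpha>"
    define M where "M = real t powr \<gamma> / (2 * C)"
    define k where "k = 2 * n div t"
    have "kernel_pow (lamplighter_kernel \<mu>) (2 * n) (f, x) (f, x)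
        \<le> range_weight (trans_prob \<mu>) (2 * n) {} x"
      using n by (intro kernel_pow_lamplighter_le_range_weight stochastic_kernel_axioms) auto
    also have "\<dots> = range_weight (trans_prob \<mu>) (2 * n mod t + k * t) {} x" by (simp add: k_def)
    also have "\<dots> \<le> (3 / 4) ^ k * (1 / 2) ^ card ({} :: 'v set) + 4 * (1 / 2) powr M"
    proof (rule range_weight_add_le_bound, rule range_weight_blocks_le)
      show "kernel_pow (trans_prob \<mu>) t x y \<le> C * real t powr - \<gamma>" for x y
        by (rule diagonal_upper) (rule t)
      show "2 * (C * real t powr - \<gamma>) * M \<le> 1"
        using t constants by (simp add: M_def powr_minus field_simps)
    qed auto
    also have "\<dots> = (3 / 4) ^ k + 4 * (1 / 2) powr M" by simp
    also have "\<dots> \<le> 2 * exp (- d * N) + 4 * exp (- d * N)"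
    proof (rule add_mono)
      have "N \<le> real k + 1"
      proof -
        have "N = real n / real n powr \<theta>"
          using n by (simp add: N_def powr_diff flip: exponent_facts(6))
        also have "\<dots> = 2 * real n / (2 * real n powr \<theta>)" by simp
        also have "\<dots> \<le> 2 * real n / real t" using t n by (intro divide_left_mono) auto
        also have "\<dots> \<le> real k + 1"
        proof -
          have "2 * n \<le> (k + 1) * t"
            using div_mult_mod_eq[of "2 * n" t] mod_less_divisor[of t "2 * n"] t
            unfolding k_def distrib_right by linarith
          then have "2 * real n \<le> (real k + 1) * real t"
            by (metis of_nat_1 of_nat_add of_nat_le_iff of_nat_mult of_nat_numeral)
          then show ?thesis using t by (simp add: pos_divide_le_eq)
        qed
        finally show ?thesis .
      qed
      then have "d * N \<le> ln (4 / 3) * (real k + 1)"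
        using d by (intro mult_mono) (auto simp: d_def N_def)
      also have "\<dots> = ln (4 / 3) - real k * ln (3 / 4)"
        by (simp add: ln_div algebra_simps)
      finally have "real k * ln (3 / 4) \<le> ln (4 / 3) + (- d * N)" by simp
      then have "exp (real k * ln (3 / 4)) \<le> exp (ln (4 / 3) + (- d * N))" by (simp only: exp_le_cancel_iff)
      then have "(3 / 4) ^ k \<le> 4 / 3 * exp (- d * N)"
        unfolding exp_add by (simp add: exp_of_nat_mult)
      also have "\<dots> \<le> 2 * exp (- d * N)" by (intro mult_right_mono) auto
      finally show "(3 / 4) ^ k \<le> 2 * exp (- d * N)" .
      have "N = (real n powr \<theta>) powr \<gamma>" using exponents by (simp add: N_def powr_powr)
      also have "\<dots> \<le> real t powr \<gamma>" using t exponent_facts by (intro powr_mono2) auto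
      finally have "d * N \<le> ln 2 / (2 * C) * real t powr \<gamma>"
        using d constants by (intro mult_mono) (auto simp: d_def N_def)
      also have "\<dots> = ln 2 * M" by (simp add: M_def)
      finally show "4 * (1 / 2) powr M \<le> 4 * exp (- d * N)"
        by (simp add: powr_def ln_div mult.commute)
    qed
    finally show ?thesis by (simp add: N_def)
  qed
  then show ?thesis using d by (intro exI[of _ 6] conjI exI[of _ d]) auto
qed

end

section \<open>Weighted graphs\<close>

lemma (in weighted_graph) graph_dist_eq_0_iff: "graph_dist E x y = 0 \<longleftrightarrow> x = y"
proof
  assume dist: "graph_dist E x y = 0"
  obtain n where "(x, y) \<in> E ^^ n" using connected[of x y] rtrancl_imp_relpow by blast
  then have "(x, y) \<in> E ^^ graph_dist E x y" unfolding graph_dist_def by (rule LeastI)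
  then show "x = y" by (simp add: dist)
qed (simp add: graph_dist_def)

lemma (in weighted_graph) graph_ball_0: "graph_ball E x 0 = {x}"
  by (auto simp: graph_ball_def graph_dist_eq_0_iff)

lemma (in weighted_graph) weight_neq_0_iff: "\<mu> x y \<noteq> 0 \<longleftrightarrow> (x, y) \<in> E"
  using weight_pos_iff[of x y] weight_nonneg[of x y] by linarith

lemma (in weighted_graph) finite_weight_support: "finite {y. \<mu> x y \<noteq> 0}"
  using locally_finite by (simp add: weight_neq_0_iff)

lemma (in weighted_graph) vertex_weight_eq_sum: "vertex_weight \<mu> x = (\<Sum>y | \<mu> x y \<noteq> 0. \<mu> x y)"
proof -
  have "vertex_weight \<mu> x = (\<Sum>\<^sub>\<infinity>y\<in>{y. \<mu> x y \<noteq> 0}. \<mu> x y)"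
    unfolding vertex_weight_def by (rule infsum_cong_neutral) auto
  then show ?thesis by (simp add: finite_weight_support)
qed

lemma (in weighted_graph) vertex_weight_pos: "0 < vertex_weight \<mu> x"
proof -
  have "\<exists>y. y \<noteq> x"
  proof (rule ccontr)
    assume "\<nexists>y. y \<noteq> x"
    then have "(UNIV :: 'v set) = {x}" by auto
    then show False using infinite_vertices by (metis finite.emptyI finite.insertI)
  qed
  then obtain y where "y \<noteq> x" by blast
  then obtain z where "(x, z) \<in> E" using connected[of x y] by (metis converse_rtranclE)
  then have "\<mu> x z \<noteq> 0" "0 < \<mu> x z" by (auto simp: weight_neq_0_iff weight_pos_iff)
  then show ?thesis unfolding vertex_weight_eq_sum
    by (intro sum_pos2[of _ z]) (auto simp: finite_weight_support weight_nonneg)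
qed

lemma (in weighted_graph) trans_prob_neq_0_iff: "trans_prob \<mu> x y \<noteq> 0 \<longleftrightarrow> \<mu> x y \<noteq> 0"
  using vertex_weight_pos[of x] by (simp add: trans_prob_def)

lemma (in weighted_graph) stochastic_kernel_trans_prob: "stochastic_kernel (trans_prob \<mu>)"
proof
  fix x y
  show "finite {z. trans_prob \<mu> x z \<noteq> 0}"
    by (simp add: trans_prob_neq_0_iff finite_weight_support[simplified])
  show "0 \<le> trans_prob \<mu> x y"
    using vertex_weight_pos[of x] weight_nonneg[of x y] by (simp add: trans_prob_def)
  have "(\<Sum>z | \<mu> x z \<noteq> 0. trans_prob \<mu> x z) = (\<Sum>z | \<mu> x z \<noteq> 0. \<mu> x z) / vertex_weight \<mu> x"
    by (simp add: trans_prob_def sum_divide_distrib)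
  also have "\<dots> = 1" using vertex_weight_pos[of x] by (simp flip: vertex_weight_eq_sum)
  finally show "(\<Sum>z | trans_prob \<mu> x z \<noteq> 0. trans_prob \<mu> x z) = 1"
    by (simp only: trans_prob_neq_0_iff)
qed

lemma (in weighted_graph) reversible_kernel_trans_prob:
  "reversible_kernel (trans_prob \<mu>) (vertex_weight \<mu>)"
proof -
  interpret stochastic_kernel "trans_prob \<mu>" by (rule stochastic_kernel_trans_prob)
  show ?thesis
  proof
    fix x y
    show "0 < vertex_weight \<mu> x" by (rule vertex_weight_pos)
    show "vertex_weight \<mu> x * trans_prob \<mu> x y = vertex_weight \<mu> y * trans_prob \<mu> y x"
      using vertex_weight_pos[of x] vertex_weight_pos[of y] symmetric[of x y]
      by (simp add: trans_prob_def)
  qed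
qed

text \<open>The volume bounds for integer radii extend to real ones at the cost of a constant. Balls are
  finite since their volume does not vanish, as a sum over an infinite set would.\<close>

lemma (in weighted_graph) volume_bounds:
  assumes "df_set_condition E \<mu> d\<^sub>f"
  obtains a b where "0 < a" "0 < b" "\<And>x. a \<le> vertex_weight \<mu> x" "\<And>x. vertex_weight \<mu> x \<le> b"
    "\<And>x r. r \<ge> 1 \<Longrightarrow> finite (graph_ball E x r)"
    "\<And>x r. r \<ge> 1 \<Longrightarrow> a * r powr d\<^sub>f \<le> volume E \<mu> x r"
    "\<And>x r. r \<ge> 1 \<Longrightarrow> volume E \<mu> x r \<le> b * r powr d\<^sub>f"
proof -
  obtain c1 c2 where c: "0 < c1" "0 < c2" "0 < d\<^sub>f"
    and vol: "\<And>x r::nat. c1 * (if r = 0 then 1 else real r powr d\<^sub>f) \<le> volume E \<mu> x (real r)"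
      "\<And>x r::nat. volume E \<mu> x (real r) \<le> c2 * (if r = 0 then 1 else real r powr d\<^sub>f)"
    using assms unfolding df_set_condition_def by meson
  have vw: "volume E \<mu> x 0 = vertex_weight \<mu> x" for x by (simp add: volume_def graph_ball_0)
  define a where "a = c1 * 2 powr - d\<^sub>f"
  have "2 powr - d\<^sub>f \<le> 2 powr (0 :: real)" using c by (intro powr_mono) auto
  then have a: "0 < a" "a \<le> c1" using c by (auto simp: a_def mult_left_le)
  have real_radius: "finite (graph_ball E x r) \<and> a * r powr d\<^sub>f \<le> volume E \<mu> x r
      \<and> volume E \<mu> x r \<le> c2 * r powr d\<^sub>f" if r: "r \<ge> 1" for x r
  proof -
    define k where "k = nat \<lfloor>r\<rfloor>"
    have k: "1 \<le> k" "real k \<le> r" "r < real k + 1" using r unfolding k_def by linarith+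
    then have r2: "r \<le> 2 * real k" by linarith
    have "real i \<le> r \<longleftrightarrow> real i \<le> real k" for i :: nat
      using k by (cases "i \<le> k") linarith+
    then have vol_eq: "volume E \<mu> x r = volume E \<mu> x (real k)"
      unfolding volume_def graph_ball_def by presburger
    have "a * r powr d\<^sub>f \<le> a * (2 * real k) powr d\<^sub>f"
      using a r2 r c by (intro mult_left_mono powr_mono2) auto
    also have "\<dots> = c1 * (2 powr - d\<^sub>f * 2 powr d\<^sub>f) * real k powr d\<^sub>f"
      by (simp only: a_def powr_mult mult.assoc)
    also have "\<dots> = c1 * real k powr d\<^sub>f" by (simp flip: powr_add)
    also have "\<dots> \<le> volume E \<mu> x r" using vol(1)[of k x] k(1) unfolding vol_eq by simp
    finally have lower: "a * r powr d\<^sub>f \<le> volume E \<mu> x r" .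
    moreover have "0 < a * r powr d\<^sub>f" using a r by simp
    ultimately have "volume E \<mu> x r \<noteq> 0" by linarith
    then have "finite (graph_ball E x r)" unfolding volume_def using sum.infinite by metis
    have "volume E \<mu> x r \<le> c2 * real k powr d\<^sub>f" using vol(2)[of x k] k(1) unfolding vol_eq by simp
    also have "\<dots> \<le> c2 * r powr d\<^sub>f" using c k by (intro mult_left_mono powr_mono2) auto
    finally show ?thesis using lower \<open>finite (graph_ball E x r)\<close> by blast
  qed
  show ?thesis
  proof (rule that[of a c2])
    show "0 < a" "0 < c2" by (rule a c)+
    show "a \<le> vertex_weight \<mu> x" "vertex_weight \<mu> x \<le> c2" for x
      using a vol(1)[of 0 x] vol(2)[of x 0] by (auto simp: vw)
    fix x r assume r: "(r :: real) \<ge> 1"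
    show "finite (graph_ball E x r)" "a * r powr d\<^sub>f \<le> volume E \<mu> x r"
      "volume E \<mu> x r \<le> c2 * r powr d\<^sub>f"
      using real_radius[OF r, of x] by blast+
  qed
qed

lemma (in weighted_graph) card_graph_ball_le:
  assumes "0 < a" "\<And>x. a \<le> vertex_weight \<mu> x"
  shows "real (card (graph_ball E x r)) \<le> volume E \<mu> x r / a"
proof -
  have "real (card (graph_ball E x r)) * a \<le> volume E \<mu> x r"
    unfolding volume_def using assms by (intro sum_bounded_below) auto
  then show ?thesis using assms by (simp add: pos_le_divide_eq)
qed

text \<open>Since \<open>V(x, n\<^bsup>1/d\<^sub>w\<^esup>)\<close> is of order \<open>n\<^bsup>\<gamma>\<^esup>\<close> and vertex weights are bounded above and below, the
  sub-Gaussian estimates turn into bounds by powers of \<open>n\<close>.\<close>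

lemma (in weighted_graph) exists_heat_kernel_bounds:
  assumes df: "df_set_condition E \<mu> d\<^sub>f"
    and hk: "sub_gaussian_estimates E \<mu> (kernel_pow (trans_prob \<mu>)) d\<^sub>w"
  shows "\<exists>a b C c C' D. heat_kernel_bounds \<mu> (vertex_weight \<mu>) (graph_ball E) d\<^sub>f d\<^sub>w a b C c C' D"
proof -
  interpret stochastic_kernel "trans_prob \<mu>" by (rule stochastic_kernel_trans_prob)
  interpret reversible_kernel "trans_prob \<mu>" "vertex_weight \<mu>" by (rule reversible_kernel_trans_prob)
  obtain a b where ab: "0 < a" "0 < b" "\<And>x. a \<le> vertex_weight \<mu> x" "\<And>x. vertex_weight \<mu> x \<le> b"
    and fin: "\<And>x r. r \<ge> 1 \<Longrightarrow> finite (graph_ball E x r)"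
    and vol: "\<And>x r. r \<ge> 1 \<Longrightarrow> a * r powr d\<^sub>f \<le> volume E \<mu> x r"
      "\<And>x r. r \<ge> 1 \<Longrightarrow> volume E \<mu> x r \<le> b * r powr d\<^sub>f"
    using volume_bounds[OF df] by blast
  let ?p = "kernel_pow (trans_prob \<mu>)" and ?\<gamma> = "d\<^sub>f / d\<^sub>w" and ?m = "vertex_weight \<mu>"
  have d: "0 < d\<^sub>f" "1 < d\<^sub>w"
    using df hk by (auto simp: df_set_condition_def sub_gaussian_estimates_def)
  obtain c1 c2 c3 c4 where c: "0 < c1" "0 < c2" "0 < c3" "0 < c4"
    and upper: "\<And>x y n. n \<ge> 1 \<Longrightarrow> ?p n x y / ?m y \<le> c1 / volume E \<mu> x (real n powr (1 / d\<^sub>w)) *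
             exp (- c2 * (real (graph_dist E x y) powr d\<^sub>w / real n) powr (1 / (d\<^sub>w - 1)))"
    and lower: "\<And>x y n. n \<ge> 1 \<Longrightarrow> graph_dist E x y \<le> n \<Longrightarrow>
          ?p n x y / ?m y + ?p (n + 1) x y / ?m y \<ge> c3 / volume E \<mu> x (real n powr (1 / d\<^sub>w)) *
               exp (- c4 * (real (graph_dist E x y) powr d\<^sub>w / real n) powr (1 / (d\<^sub>w - 1)))"
    using hk unfolding sub_gaussian_estimates_def by meson
  have rad: "1 \<le> real n powr (1 / d\<^sub>w)" "(real n powr (1 / d\<^sub>w)) powr d\<^sub>f = real n powr ?\<gamma>"
    if "n \<ge> 1" for n :: nat
    using that d by (auto simp: powr_powr intro!: ge_one_powr_ge_zero)
  have gauss: "?p n x y \<le> b * c1 / a * real n powr - ?\<gamma> *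
      exp (- c2 * (real (graph_dist E x y) powr d\<^sub>w / real n) powr (1 / (d\<^sub>w - 1)))"
    (is "_ \<le> _ * _ * ?e") if n: "n \<ge> 1" for n x y
  proof -
    let ?V = "volume E \<mu> x (real n powr (1 / d\<^sub>w))"
    have V: "a * real n powr ?\<gamma> \<le> ?V" using vol(1)[OF rad(1)[OF n], of x] rad(2)[OF n] by simp
    have pos: "0 < a * real n powr ?\<gamma>" using ab n by simp
    have "?p n x y = ?m y * (?p n x y / ?m y)" using vertex_weight_pos[of y] by simp
    also have "\<dots> \<le> b * (?p n x y / ?m y)"
      using ab vertex_weight_pos[of y] kernel_pow_nonneg by (intro mult_right_mono divide_nonneg_pos) auto
    also have "\<dots> \<le> b * (c1 / ?V * ?e)" using upper[OF n] ab by (intro mult_left_mono) auto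
    also have "\<dots> \<le> b * (c1 / (a * real n powr ?\<gamma>) * ?e)"
      using V pos c ab by (intro mult_left_mono mult_right_mono divide_left_mono) auto
    also have "\<dots> = b * c1 / a * real n powr - ?\<gamma> * ?e" by (simp add: powr_minus divide_inverse)
    finally show ?thesis .
  qed
  have "heat_kernel_bounds \<mu> ?m (graph_ball E) d\<^sub>f d\<^sub>w a b (b * c1 / a) c2 (a * c3 / b) (b / a)"
  proof unfold_locales
    fix x y :: 'v and r :: real and n :: nat
    show "0 < d\<^sub>f" "1 < d\<^sub>w" "0 < a" "0 < b" "0 < c2" "a \<le> ?m x" "?m x \<le> b"
      by (rule d ab c)+
    show "0 < b * c1 / a" "0 < a * c3 / b" "0 < b / a" using ab c by auto
    show "x \<in> graph_ball E x r" if "r \<ge> 1"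
      using that graph_dist_eq_0_iff[of x x] by (simp add: graph_ball_def)
    show "finite (graph_ball E x r)" if "r \<ge> 1" using fin that .
    show "real (card (graph_ball E x r)) \<le> b / a * r powr d\<^sub>f" if r: "r \<ge> 1"
    proof -
      have "real (card (graph_ball E x r)) \<le> volume E \<mu> x r / a"
        by (intro card_graph_ball_le ab)
      also have "\<dots> \<le> b * r powr d\<^sub>f / a" using vol(2)[OF r] ab by (intro divide_right_mono) auto
      finally show ?thesis by simp
    qed
    show "?p n x y \<le> b * c1 / a * real n powr - ?\<gamma>" if "n \<ge> 1"
    proof (rule order_trans[OF gauss[OF that]])
      show "b * c1 / a * real n powr - ?\<gamma> *
          exp (- c2 * (real (graph_dist E x y) powr d\<^sub>w / real n) powr (1 / (d\<^sub>w - 1)))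
        \<le> b * c1 / a * real n powr - ?\<gamma>"
        using ab c by (intro mult_right_le_one_le) auto
    qed
    show "?p n x y \<le> b * c1 / a * real n powr - ?\<gamma> *
        exp (- c2 * (r powr d\<^sub>w / real n) powr (1 / (d\<^sub>w - 1)))"
      if n: "n \<ge> 1" and r: "r \<ge> 1" and y: "y \<notin> graph_ball E x r"
    proof (rule order_trans[OF gauss[OF n]])
      have "r powr d\<^sub>w \<le> real (graph_dist E x y) powr d\<^sub>w"
        using y r d by (intro powr_mono2) (auto simp: graph_ball_def)
      then have "r powr d\<^sub>w / real n \<le> real (graph_dist E x y) powr d\<^sub>w / real n"
        by (intro divide_right_mono) auto
      then have "(r powr d\<^sub>w / real n) powr (1 / (d\<^sub>w - 1))
          \<le> (real (graph_dist E x y) powr d\<^sub>w / real n) powr (1 / (d\<^sub>w - 1))"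
        using d by (intro powr_mono2) auto
      then show "b * c1 / a * real n powr - ?\<gamma> *
          exp (- c2 * (real (graph_dist E x y) powr d\<^sub>w / real n) powr (1 / (d\<^sub>w - 1)))
        \<le> b * c1 / a * real n powr - ?\<gamma> *
          exp (- c2 * (r powr d\<^sub>w / real n) powr (1 / (d\<^sub>w - 1)))"
        using ab c by (intro mult_left_mono) auto
    qed
    show "a * c3 / b * real n powr - ?\<gamma> \<le> ?p n x x + ?p (n + 1) x x" if n: "n \<ge> 1"
    proof -
      let ?V = "volume E \<mu> x (real n powr (1 / d\<^sub>w))"
      have V: "?V \<le> b * real n powr ?\<gamma>" "0 < ?V"
        using vol[OF rad(1)[OF n], of x] rad(2)[OF n] ab n
        by (auto intro: less_le_trans[of _ "a * real n powr ?\<gamma>"])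
      have dist: "graph_dist E x x = 0" by (simp add: graph_dist_eq_0_iff)
      have "a * c3 / b * real n powr - ?\<gamma> = a * (c3 / (b * real n powr ?\<gamma>))"
        by (simp add: powr_minus divide_inverse)
      also have "\<dots> \<le> a * (c3 / ?V)"
        using V c ab n by (intro mult_left_mono divide_left_mono mult_pos_pos) auto
      also have "\<dots> \<le> ?m x * (c3 / ?V)" using ab V c by (intro mult_right_mono) auto
      also have "\<dots> \<le> ?m x * (?p n x x / ?m x + ?p (n + 1) x x / ?m x)"
        using lower[OF n, of x x] vertex_weight_pos[of x] d by (intro mult_left_mono) (auto simp: dist)
      also have "\<dots> = ?p n x x + ?p (n + 1) x x"
        using vertex_weight_pos[of x] by (simp add: field_simps)
      finally show ?thesis .
    qed
  qed
  then show ?thesis by blast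
qed

theorem theorem2p3:
  fixes E :: "('v \<times> 'v) set" and \<mu> :: "'v \<Rightarrow> 'v \<Rightarrow> real"
    and d\<^sub>f d\<^sub>w :: real
    and P :: "'v \<Rightarrow> 'a measure" and X :: "nat \<Rightarrow> 'a \<Rightarrow> 'v"
    and P' :: "'v wreath \<Rightarrow> 'b measure" and Y :: "nat \<Rightarrow> 'b \<Rightarrow> 'v wreath"
  assumes "weighted_graph E \<mu>"
    and "\<And>x. markov_chain (trans_prob \<mu>) x (P x) X"
    and "\<And>x. markov_chain (lamplighter_kernel \<mu>) x (P' x) Y"
    and "p0_condition E \<mu>"
    and "df_set_condition E \<mu> d\<^sub>f"
    and "sub_gaussian_estimates E \<mu> (n_step_prob P X) d\<^sub>w"
  shows "\<exists>c\<^sub>1>0. \<exists>c\<^sub>2>0. \<exists>c\<^sub>3>0. \<exists>c\<^sub>4>0. \<forall>x :: 'v wreath. \<forall>n :: nat.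
           c\<^sub>1 * exp (- ((c\<^sub>2 * real n) powr (d\<^sub>f / (d\<^sub>f + d\<^sub>w))))
             \<le> n_step_prob P' Y (2 * n) x x / wreath_weight \<mu> x \<and>
           n_step_prob P' Y (2 * n) x x / wreath_weight \<mu> x
             \<le> c\<^sub>3 * exp (- ((c\<^sub>4 * real n) powr (d\<^sub>f / (d\<^sub>f + d\<^sub>w))))"
proof -
  interpret weighted_graph E \<mu> by fact
  let ?L = "kernel_pow (lamplighter_kernel \<mu>)" and ?m = "vertex_weight \<mu>"
  have stoch: "stochastic_kernel (trans_prob \<mu>)" "stochastic_kernel (lamplighter_kernel \<mu>)"
    using stochastic_kernel_trans_prob stochastic_kernel_lamplighter by blast+
  interpret L: stochastic_kernel "lamplighter_kernel \<mu>" by (rule stoch)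
  have "n_step_prob P X = kernel_pow (trans_prob \<mu>)"
    by (intro ext) (simp add: n_step_prob_def markov_chain_prob_eq_kernel_pow[OF stoch(1) assms(2)])
  then have "\<exists>a b C c C' D. heat_kernel_bounds \<mu> ?m (graph_ball E) d\<^sub>f d\<^sub>w a b C c C' D"
    using exists_heat_kernel_bounds[OF assms(5)] assms(6) by simp
  then obtain a b C c C' D where "heat_kernel_bounds \<mu> ?m (graph_ball E) d\<^sub>f d\<^sub>w a b C c C' D"
    by blast
  then interpret heat_kernel_bounds \<mu> ?m "graph_ball E" d\<^sub>f d\<^sub>w a b C c C' D .
  obtain l1 l2 where l: "0 < l1" "0 < l2"
    "\<And>n f x. n \<ge> 1 \<Longrightarrow> l1 * exp (- l2 * real n powr \<alpha>) \<le> ?L (2 * n) (f, x) (f, x)"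
    using lamplighter_return_lower by blast
  obtain u1 u2 where u: "0 < u1" "0 < u2"
    "\<And>n f x. n \<ge> 1 \<Longrightarrow> ?L (2 * n) (f, x) (f, x) \<le> u1 * exp (- u2 * real n powr \<alpha>)"
    using lamplighter_return_upper by blast
  \<comment> \<open>The constants of the exponents move inside the power; time \<open>0\<close> is covered by the minimum and the
    maximum with \<open>1\<close>.\<close>
  have scale: "(s powr (1 / \<alpha>) * real n) powr \<alpha> = s * real n powr \<alpha>" if "0 < s" for s n
    using that exponents by (simp add: powr_mult powr_powr)
  have "min 1 l1 / b * exp (- ((l2 powr (1 / \<alpha>) * real n) powr \<alpha>))
        \<le> n_step_prob P' Y (2 * n) w w / wreath_weight \<mu> w \<and>
      n_step_prob P' Y (2 * n) w w / wreath_weight \<mu> w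
        \<le> max 1 u1 / a * exp (- ((u2 powr (1 / \<alpha>) * real n) powr \<alpha>))" for w n
  proof -
    obtain f x where w: "w = (f, x)" by force
    have step: "n_step_prob P' Y (2 * n) w w = ?L (2 * n) (f, x) (f, x)"
      by (simp add: n_step_prob_def w markov_chain_prob_eq_kernel_pow[OF stoch(2) assms(3)])
    have L: "min 1 l1 * exp (- l2 * real n powr \<alpha>) \<le> ?L (2 * n) (f, x) (f, x)"
      "?L (2 * n) (f, x) (f, x) \<le> max 1 u1 * exp (- u2 * real n powr \<alpha>)"
    proof -
      show "min 1 l1 * exp (- l2 * real n powr \<alpha>) \<le> ?L (2 * n) (f, x) (f, x)"
      proof (cases "n = 0")
        case False
        have "min 1 l1 * exp (- l2 * real n powr \<alpha>) \<le> l1 * exp (- l2 * real n powr \<alpha>)"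
          by (intro mult_right_mono) auto
        also have "\<dots> \<le> ?L (2 * n) (f, x) (f, x)" using False by (intro l) auto
        finally show ?thesis .
      qed (simp add: kernel_pow_0)
      show "?L (2 * n) (f, x) (f, x) \<le> max 1 u1 * exp (- u2 * real n powr \<alpha>)"
      proof (cases "n = 0")
        case False
        have "?L (2 * n) (f, x) (f, x) \<le> u1 * exp (- u2 * real n powr \<alpha>)"
          using False by (intro u) auto
        also have "\<dots> \<le> max 1 u1 * exp (- u2 * real n powr \<alpha>)" by (intro mult_right_mono) auto
        finally show ?thesis .
      qed (simp add: kernel_pow_0)
    qed
    have m: "0 < ?m x" by (rule vertex_weight_pos)
    have "min 1 l1 * exp (- l2 * real n powr \<alpha>) / b \<le> ?L (2 * n) (f, x) (f, x) / ?m x"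
      using L l m weight_bounds[of x] L.kernel_pow_nonneg by (intro frac_le) auto
    moreover have "?L (2 * n) (f, x) (f, x) / ?m x \<le> max 1 u1 * exp (- u2 * real n powr \<alpha>) / a"
      using L u m weight_bounds[of x] constants by (intro frac_le) auto
    ultimately show ?thesis
      unfolding scale[OF l(2)] scale[OF u(2)] step by (simp add: w)
  qed
  moreover have "0 < min 1 l1 / b" "0 < l2 powr (1 / \<alpha>)" "0 < max 1 u1 / a" "0 < u2 powr (1 / \<alpha>)"
    using l u constants by auto
  ultimately show ?thesis by blast
qed

end
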